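(* Suppose that $\mathbb G$ is a countable locally compact, Abelian, Polish topological group, that $(X,T,\alpha)$ is a mixing topological Markov shift, that $\mathbb F$ is a subgroup of $\mathbb G$, and that $\phi:X\to\mathbb G$ is $\alpha$-measurable and of the form $\phi=a+g-g\circ T+\overline\phi$, where $a\in\mathbb G$, $g:X\to\mathbb G$ is $\alpha$-measurable and $\overline\phi:X\to\mathbb F$ is $\alpha$-measurable and aperiodic. If $\nu$ is a $\sigma$-finite measure on $X$ which is locally finite, has clopen support $U$, is recurrent and is $\mathfrak T(T,\phi)$-invariant and ergodic, then $U=[g\in z_0+\mathbb F]$ for some $z_0\in\mathbb G$, and there exist a homomorphism $h:\mathbb G\to\mathbb R$, $c>0$ and a Markov measure $\mu\in\mathfrak M_\alpha(X)$ such that $$\frac{d\mu\circ T}{d\mu}=c\,e^{h\circ\phi},\qquad \nu=\mu|_U.$$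
   Context: A topological Markov shift with countable state space $S$ and $\{0,1\}$-transition matrix $A$ is $X=\{x\in S^{\mathbb N}: A_{x_i,x_{i+1}}=1\ \forall i\ge1\}$ with the left shift $T$, the partition $\alpha=\{[s]:s\in S\}$, $[s]=\{x\in X:x_1=s\}$ (nonempty), and the topology generated by the cylinders $[s_1,\dots,s_n]$. It is mixing if for all $a,b\in\alpha$, $a\cap T^{-n}b\neq\emptyset$ for all large $n$. A function on $X$ is $\alpha$-measurable if it is constant on each $a\in\alpha$. $[g\in B]$ denotes $\{x\in X:g(x)\in B\}$. For a function $\phi$ from $X$ to an abelian topological group $\mathbb H$ write $\phi_n=\sum_{k=0}^{n-1}\phi\circ T^k$; $\phi:X\to\mathbb H$ is aperiodic if the subgroup generated by $\{\phi_n(x)-\phi_n(y): n\ge1,\ T^nx=x,\ T^ny=y\}$ is dense in $\mathbb H$ (here $\overline\phi$ is aperiodic as a map into $\mathbb H=\mathbb F$). Let $\mathfrak T(T,\phi)=\{(x,y)\in X^2:\exists n\ge0,\ T^nx=T^ny,\ \phi_n(x)=\phi_n(y)\}$. For a countable Borel equivalence relation $\mathcal R$, an $\mathcal R$-holonomy is a bi-measurable bijection $\kappa:A\to B$ of measurable sets with $(x,\kappa x)\in\mathcal R$ for all $x\in A$. A measure $\nu$ is $\mathcal R$-invariant if $\nu(\kappa(C))=\nu(C)$ for all holonomies $\kappa$ and measurable $C$ in the domain of $\kappa$; it is $\mathcal R$-ergodic if every measurable union of $\mathcal R$-classes is null or conull. $\nu$ is locally finite if $X$ has a countable cover by open sets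 of finite measure; recurrent if for each $a\in\alpha$, $\sum_{n\ge0}1_a\circ T^n\in\{0,\infty\}$ $\nu$-a.e. $\mathfrak M_\alpha(X)$ is the set of $\sigma$-finite measures finite on each $a\in\alpha$. $\mu$ is Markov if $\mu([s_1,\dots,s_n])=\mu([s_1])p_{s_1,s_2}\cdots p_{s_{n-1},s_n}$ for some stochastic matrix $(p_{s,t})$. $\frac{d\mu\circ T}{d\mu}$ is the Radon–Nikodym derivative of $B\mapsto\mu(TB)$ with respect to $\mu$, taken on each $a\in\alpha$ (where $T$ is injective). *)

theory Defs
  imports "HOL-Analysis.Analysis" "HOL-Computational_Algebra.Group_Closure"
begin

section \<open>Topological Markov shifts\<close>

text \<open>
  The state space is the type \<open>'s\<close>; the \<open>{0,1}\<close>-matrix is the predicate \<open>A\<close>, with \<open>A s t\<close> meaning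
  that the entry at \<open>(s, t)\<close> is 1.  Sequences are indexed from 0.
\<close>

definition tms :: "('s \<Rightarrow> 's \<Rightarrow> bool) \<Rightarrow> (nat \<Rightarrow> 's) set" where
  "tms A = {x. \<forall>i. A (x i) (x (Suc i))}"

definition shift :: "(nat \<Rightarrow> 's) \<Rightarrow> (nat \<Rightarrow> 's)" where
  "shift x = (\<lambda>i. x (Suc i))"

definition cyl :: "('s \<Rightarrow> 's \<Rightarrow> bool) \<Rightarrow> 's list \<Rightarrow> (nat \<Rightarrow> 's) set" where
  "cyl A w = {x \<in> tms A. \<forall>i < length w. x i = w ! i}"

definition tms_partition :: "('s \<Rightarrow> 's \<Rightarrow> bool) \<Rightarrow> (nat \<Rightarrow> 's) set set" where
  "tms_partition A = {cyl A [s] | s. True}"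

definition tms_topology :: "('s \<Rightarrow> 's \<Rightarrow> bool) \<Rightarrow> (nat \<Rightarrow> 's) topology" where
  "tms_topology A = topology_generated_by {cyl A w | w. w \<noteq> []}"

definition tms_borel :: "('s \<Rightarrow> 's \<Rightarrow> bool) \<Rightarrow> (nat \<Rightarrow> 's) measure" where
  "tms_borel A = sigma (tms A) {V. openin (tms_topology A) V}"

definition mixing :: "('s \<Rightarrow> 's \<Rightarrow> bool) \<Rightarrow> bool" where
  "mixing A \<longleftrightarrow> (\<forall>a \<in> tms_partition A. \<forall>b \<in> tms_partition A.
     \<exists>N. \<forall>n \<ge> N. a \<inter> {x \<in> tms A. (shift ^^ n) x \<in> b} \<noteq> {})"

text \<open>Functions on the shift are total functions on sequences; only their values on \<open>tms A\<close> matter.\<close>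

definition partition_measurable :: "('s \<Rightarrow> 's \<Rightarrow> bool) \<Rightarrow> ((nat \<Rightarrow> 's) \<Rightarrow> 'b) \<Rightarrow> bool" where
  "partition_measurable A f \<longleftrightarrow> (\<forall>a \<in> tms_partition A. f constant_on a)"

section \<open>Cocycles\<close>

definition add_subgroup :: "'g::ab_group_add set \<Rightarrow> bool" where
  "add_subgroup F \<longleftrightarrow> 0 \<in> F \<and> (\<forall>x \<in> F. \<forall>y \<in> F. x + y \<in> F) \<and> (\<forall>x \<in> F. - x \<in> F)"

definition birkhoff_sum :: "((nat \<Rightarrow> 's) \<Rightarrow> 'g::comm_monoid_add) \<Rightarrow> nat \<Rightarrow> (nat \<Rightarrow> 's) \<Rightarrow> 'g" where
  "birkhoff_sum f n x = (\<Sum>k<n. f ((shift ^^ k) x))"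

text \<open>Aperiodicity of \<open>f\<close> as a map into the group \<open>H\<close> with the subspace topology.\<close>

definition aperiodic_into ::
  "('s \<Rightarrow> 's \<Rightarrow> bool) \<Rightarrow> 'g::topological_ab_group_add set \<Rightarrow> ((nat \<Rightarrow> 's) \<Rightarrow> 'g) \<Rightarrow> bool" where
  "aperiodic_into A H f \<longleftrightarrow>
     top_of_set H closure_of
       group_closure {birkhoff_sum f n x - birkhoff_sum f n y | n x y.
         n \<ge> 1 \<and> x \<in> tms A \<and> y \<in> tms A \<and> (shift ^^ n) x = x \<and> (shift ^^ n) y = y} = H"

definition tail_rel ::
  "('s \<Rightarrow> 's \<Rightarrow> bool) \<Rightarrow> ((nat \<Rightarrow> 's) \<Rightarrow> 'g::comm_monoid_add) \<Rightarrow> ((nat \<Rightarrow> 's) \<times> (nat \<Rightarrow> 's)) set" where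
  "tail_rel A f = {(x, y). x \<in> tms A \<and> y \<in> tms A \<and>
     (\<exists>n. (shift ^^ n) x = (shift ^^ n) y \<and> birkhoff_sum f n x = birkhoff_sum f n y)}"

section \<open>Invariance and ergodicity for equivalence relations\<close>

definition holonomy ::
  "'a measure \<Rightarrow> ('a \<times> 'a) set \<Rightarrow> ('a \<Rightarrow> 'a) \<Rightarrow> 'a set \<Rightarrow> 'a set \<Rightarrow> bool" where
  "holonomy M R \<kappa> C D \<longleftrightarrow>
     C \<in> sets M \<and> D \<in> sets M \<and> bij_betw \<kappa> C D \<and>
     \<kappa> \<in> measurable (restrict_space M C) (restrict_space M D) \<and>
     the_inv_into C \<kappa> \<in> measurable (restrict_space M D) (restrict_space M C) \<and>
     (\<forall>x \<in> C. (x, \<kappa> x) \<in> R)"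

definition rel_invariant :: "('a \<times> 'a) set \<Rightarrow> 'a measure \<Rightarrow> bool" where
  "rel_invariant R M \<longleftrightarrow>
     (\<forall>\<kappa> C D. holonomy M R \<kappa> C D \<longrightarrow>
        (\<forall>B \<in> sets M. B \<subseteq> C \<longrightarrow> emeasure M (\<kappa> ` B) = emeasure M B))"

definition rel_ergodic :: "('a \<times> 'a) set \<Rightarrow> 'a measure \<Rightarrow> bool" where
  "rel_ergodic R M \<longleftrightarrow>
     (\<forall>\<C>. \<C> \<subseteq> space M // R \<and> \<Union>\<C> \<in> sets M \<longrightarrow>
        emeasure M (\<Union>\<C>) = 0 \<or> emeasure M (space M - \<Union>\<C>) = 0)"

section \<open>Measures on the shift\<close>

definition locally_finite_measure :: "'a topology \<Rightarrow> 'a measure \<Rightarrow> bool" where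
  "locally_finite_measure \<tau> M \<longleftrightarrow>
     (\<exists>\<V>. countable \<V> \<and> (\<forall>V \<in> \<V>. openin \<tau> V \<and> emeasure M V < \<infinity>) \<and> \<Union>\<V> = topspace \<tau>)"

definition topological_support :: "'a topology \<Rightarrow> 'a measure \<Rightarrow> 'a set" where
  "topological_support \<tau> M =
     {x \<in> topspace \<tau>. \<forall>V. openin \<tau> V \<and> x \<in> V \<longrightarrow> emeasure M V > 0}"

definition recurrent_measure :: "('s \<Rightarrow> 's \<Rightarrow> bool) \<Rightarrow> (nat \<Rightarrow> 's) measure \<Rightarrow> bool" where
  "recurrent_measure A M \<longleftrightarrow>
     (\<forall>a \<in> tms_partition A.
        AE x in M. (\<Sum>n. indicator a ((shift ^^ n) x) :: ennreal) \<in> {0, \<infinity>})"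

definition partition_finite_measures :: "('s \<Rightarrow> 's \<Rightarrow> bool) \<Rightarrow> (nat \<Rightarrow> 's) measure set" where
  "partition_finite_measures A =
     {M. sets M = sets (tms_borel A) \<and> sigma_finite_measure M \<and>
         (\<forall>a \<in> tms_partition A. emeasure M a < \<infinity>)}"

definition stochastic_matrix :: "('s \<Rightarrow> 's \<Rightarrow> real) \<Rightarrow> bool" where
  "stochastic_matrix p \<longleftrightarrow> (\<forall>s t. p s t \<ge> 0) \<and> (\<forall>s. (p s has_sum 1) UNIV)"

definition markov_measure :: "('s \<Rightarrow> 's \<Rightarrow> bool) \<Rightarrow> (nat \<Rightarrow> 's) measure \<Rightarrow> bool" where
  "markov_measure A M \<longleftrightarrow>
     (\<exists>p. stochastic_matrix p \<and>
        (\<forall>w. w \<noteq> [] \<longrightarrow>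
           emeasure M (cyl A w) =
             emeasure M (cyl A [hd w]) * (\<Prod>i < length w - 1. ennreal (p (w ! i) (w ! Suc i)))))"

text \<open>
  \<open>f\<close> is a version of \<open>d(M \<circ> T)/dM\<close>: on every \<open>a \<in> \<alpha>\<close> the measure \<open>B \<mapsto> M (T B)\<close> has density \<open>f\<close> with
  respect to \<open>M\<close>.  Globally \<open>B \<mapsto> M (T B)\<close> is not additive, so \<open>RN_deriv\<close> cannot be applied to it directly.
\<close>

definition is_shift_RN_deriv ::
  "('s \<Rightarrow> 's \<Rightarrow> bool) \<Rightarrow> (nat \<Rightarrow> 's) measure \<Rightarrow> ((nat \<Rightarrow> 's) \<Rightarrow> ennreal) \<Rightarrow> bool" where
  "is_shift_RN_deriv A M f \<longleftrightarrow>
     f \<in> borel_measurable M \<and>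
     (\<forall>a \<in> tms_partition A. \<forall>B \<in> sets M. B \<subseteq> a \<longrightarrow>
        emeasure M (shift ` B) = (\<integral>\<^sup>+x\<in>B. f x \<partial>M))"

end

theory Submission
  imports Defs "HOL-Library.Omega_Words_Fun"
begin

text \<open>
  All the functions depend on the first coordinate only, so that the Birkhoff sums of \<open>\<phi>\<close> are sums along
  words. Invariance under the tail relation means that an initial word may be replaced by another
  one of the same length, with the same sum and leading to the same state, without changing the
  measure (\<open>exchange\<close>).

  The argument resembles the proof of de Finetti's theorem by extremality. Fix a state \<open>u\<close> of positive
  measure. By recurrence the points starting with \<open>u\<close> are, up to a null set, sequences of first return
  words; exchanges permute these words, whence \<open>\<nu>\<close> is there invariant under the first return map
  (\<open>first_return_invariant\<close>). Thus \<open>\<nu>\<close> is the sum over the first return words \<open>w\<close> of the measures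
  \<open>B \<mapsto> \<nu> (w B)\<close>. Each of them is dominated by \<open>\<nu>\<close> and is also invariant, so that its density is constant
  by ergodicity (\<open>ergodic_proportional\<close>). Hence for every loop \<open>w\<close> at \<open>u\<close> there is a multiplier \<open>\<lambda>\<close>
  with \<open>\<nu> (w B) = \<lambda> \<nu> (B)\<close> for all \<open>B\<close> in the state \<open>u\<close>. Together with local finiteness this shows that the
  state has finite measure; since the support is open, all these multipliers are positive.

  The multiplier of a loop depends only on the length and the sum of the loop, and it is multiplicative
  under concatenation. Its logarithm is thus an additive function on a submonoid of the product of the
  integers with the group, and by divisibility of the reals it extends to a homomorphism of the product
  (\<open>additive_extension_from_submonoid\<close>). This provides \<open>h\<close> and \<open>c\<close> such that a loop of length \<open>n\<close> with sum \<open>z\<close>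
  has the multiplier \<open>c powr (- n) * exp (- h z)\<close>. The measure \<open>\<mu>\<close> is built from \<open>\<nu>\<close> on the state \<open>u\<close> by
  prepending the words that reach \<open>u\<close> for the first time, with weights given by the same formula
  (\<open>conformal_measure_exists\<close>); prepending a letter then changes \<open>\<mu>\<close> by the prescribed factor, and
  this makes \<open>\<mu>\<close> a Markov measure with the required derivative.

  It remains to describe the states of positive measure and to compare \<open>\<mu>\<close> with \<open>\<nu>\<close> on them. A countable
  Polish group is discrete, so by aperiodicity and mixing the differences of the sums of \<open>\<phi>'\<close> along two
  loops at \<open>u\<close>, of lengths with a given difference, fill \<open>F\<close> (\<open>loop_differences_length\<close>). So every state
  \<open>t\<close> on which the value of \<open>g\<close> differs from the one on \<open>u\<close> by an element of \<open>F\<close> admits a word to \<open>u\<close> which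
  can be exchanged for a loop at \<open>u\<close> (\<open>linked_states\<close>). This makes \<open>t\<close> a state of positive measure on which
  \<open>\<mu>\<close> equals \<open>\<nu>\<close>. Conversely, the set where \<open>g\<close> lies in a given coset of \<open>F\<close> is invariant under the tail
  relation, so that by ergodicity \<open>\<nu>\<close> lives on one such set.
\<close>

section \<open>Words and cylinders\<close>

lemma shift_funpow: "(shift ^^ n) x = suffix n x"
  by (induction n arbitrary: x) (auto simp: shift_def fun_eq_iff funpow_swap1)

lemma conc_nth_0: "(w \<frown> y) 0 = hd (w @ [y 0])"
  by (cases w) auto

lemma build_in_tms: "a ## x \<in> tms A \<longleftrightarrow> A a (x 0) \<and> x \<in> tms A"
proof -
  have "(\<forall>i. A ((a ## x) i) ((a ## x) (Suc i))) \<longleftrightarrow> A a (x 0) \<and> (\<forall>i. A (x i) (x (Suc i)))"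
    (is "(\<forall>i. ?P i) \<longleftrightarrow> ?Q")
  proof
    assume *: "\<forall>i. ?P i"
    show ?Q
      using *[THEN spec, of 0] *[THEN spec, of "Suc _"] by auto
  next
    assume *: ?Q
    show "\<forall>i. ?P i"
    proof
      fix i show "?P i" using * by (cases i) auto
    qed
  qed
  then show ?thesis
    by (simp add: tms_def)
qed

lemma conc_in_tms: "w \<frown> y \<in> tms A \<longleftrightarrow> y \<in> tms A \<and> successively A (w @ [y 0])"
  by (induction w) (auto simp: build_in_tms conc_nth_0 successively_Cons)

lemma suffix_in_tms: "x \<in> tms A \<Longrightarrow> suffix n x \<in> tms A"
  by (simp add: tms_def)

lemma cyl_iff: "x \<in> cyl A w \<longleftrightarrow> x \<in> tms A \<and> prefix (length w) x = w"
proof -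
  have "(\<forall>i<length w. x i = w ! i) \<longleftrightarrow> prefix (length w) x = w"
    by (subst list_eq_iff_nth_eq) simp
  then show ?thesis
    by (simp add: cyl_def)
qed

lemma cyl_Nil [simp]: "cyl A [] = tms A"
  by (simp add: cyl_def)

lemma cyl_single_iff: "x \<in> cyl A [s] \<longleftrightarrow> x \<in> tms A \<and> x 0 = s"
  by (simp add: cyl_def)

text \<open>
  The set \<open>w B\<close> of the points of the shift space that consist of the word \<open>w\<close> followed by a point
  of \<open>B\<close>, and the set of the points \<open>y\<close> with \<open>w y \<in> B\<close>. The word need not be admissible, nor followed
  admissibly by the points of \<open>B\<close>: inadmissible sequences are left out of \<open>w B\<close>, so that sums
  over all words need no side conditions.
\<close>

definition prepend :: "('s \<Rightarrow> 's \<Rightarrow> bool) \<Rightarrow> 's list \<Rightarrow> (nat \<Rightarrow> 's) set \<Rightarrow> (nat \<Rightarrow> 's) set" where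
  "prepend A w B = {x \<in> cyl A w. suffix (length w) x \<in> B}"

definition pull :: "('s \<Rightarrow> 's \<Rightarrow> bool) \<Rightarrow> 's list \<Rightarrow> (nat \<Rightarrow> 's) set \<Rightarrow> (nat \<Rightarrow> 's) set" where
  "pull A w B = {y \<in> tms A. w \<frown> y \<in> B}"

lemma prependE:
  assumes "x \<in> prepend A w B"
  obtains y where "x = w \<frown> y" "y \<in> B" "w \<frown> y \<in> tms A" "y \<in> tms A"
  using assms prefix_suffix[of x "length w"] suffix_in_tms[of x A "length w"]
  by (auto simp: prepend_def cyl_iff)

lemma conc_in_prepend [simp]: "w \<frown> y \<in> prepend A w B \<longleftrightarrow> w \<frown> y \<in> tms A \<and> y \<in> B"
  by (auto simp: prepend_def cyl_iff)

lemma prepend_Nil: "B \<subseteq> tms A \<Longrightarrow> prepend A [] B = B"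
  by (auto simp: prepend_def)

lemma prepend_prepend: "prepend A v (prepend A w B) = prepend A (v @ w) B"
proof (intro set_eqI iffI)
  fix x assume "x \<in> prepend A v (prepend A w B)"
  then show "x \<in> prepend A (v @ w) B"
    by (metis conc_conc conc_in_prepend prependE)
next
  fix x assume "x \<in> prepend A (v @ w) B"
  then obtain y where "x = (v @ w) \<frown> y" "y \<in> B" "(v @ w) \<frown> y \<in> tms A"
    by (elim prependE)
  moreover from this have "w \<frown> y \<in> tms A"
    by (metis conc_conc conc_in_tms)
  ultimately show "x \<in> prepend A v (prepend A w B)"
    by (metis conc_conc conc_in_prepend)
qed

lemma prepend_cyl: "prepend A v (cyl A w) = cyl A (v @ w)"
proof -
  have "cyl A u = prepend A u (tms A)" for u
    by (auto simp: prepend_def cyl_iff suffix_in_tms)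
  then show ?thesis
    by (simp only: prepend_prepend)
qed

lemma prepend_subset_cyl: "prepend A w B \<subseteq> cyl A w"
  by (auto simp: prepend_def)

lemma prepend_mono: "B \<subseteq> C \<Longrightarrow> prepend A w B \<subseteq> prepend A w C"
  by (auto simp: prepend_def)

lemma cyl_subset_tms: "cyl A w \<subseteq> tms A"
  by (auto simp: cyl_def)

lemma cyl_append_subset: "cyl A (v @ w) \<subseteq> cyl A v"
  by (auto simp: cyl_def nth_append)

lemma prepend_subset_tms: "prepend A w B \<subseteq> tms A"
  by (auto simp: prepend_def cyl_def)

lemma prepend_pull: "prepend A w (pull A w B) = B \<inter> cyl A w"
proof (intro set_eqI iffI)
  fix x assume "x \<in> prepend A w (pull A w B)"
  then show "x \<in> B \<inter> cyl A w"
    by (auto elim!: prependE simp: pull_def cyl_iff)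
next
  fix x assume x: "x \<in> B \<inter> cyl A w"
  then have "x = w \<frown> suffix (length w) x"
    using prefix_suffix[of x "length w"] by (simp add: cyl_iff)
  with x show "x \<in> prepend A w (pull A w B)"
    by (auto simp: prepend_def pull_def suffix_in_tms cyl_iff)
qed

lemma cyl_prefix: "x \<in> tms A \<Longrightarrow> x \<in> cyl A (prefix n x)"
  by (simp add: cyl_iff)

lemma first_visit_unique:
  assumes "y \<in> cyl A (r @ [u])" "y \<in> cyl A (r' @ [u])" "u \<notin> set r" "u \<notin> set r'"
  shows "r = r'"
proof -
  have *: "prefix (length r) y = r \<and> y (length r) = u \<and> (\<forall>i<length r. y i \<noteq> u)"
    if "y \<in> cyl A (r @ [u])" "u \<notin> set r" for r
  proof -
    have "\<forall>i<Suc (length r). y i = (r @ [u]) ! i"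
      using that by (simp add: cyl_def)
    then have eq: "y i = r ! i" if "i < length r" for i
      using that by (auto simp: nth_append)
    moreover have "y (length r) = u"
      using \<open>\<forall>i<Suc (length r). y i = (r @ [u]) ! i\<close> by auto
    ultimately show ?thesis
      using \<open>u \<notin> set r\<close> by (auto intro!: nth_equalityI simp: in_set_conv_nth)
  qed
  then have "length r = length r'"
    using *[OF assms(1,3)] *[OF assms(2,4)] by (metis linorder_neqE_nat)
  then show ?thesis
    using *[OF assms(1,3)] *[OF assms(2,4)] by metis
qed

lemma first_visit_exists:
  assumes "y \<in> tms A" "\<exists>m. y m = u"
  obtains r where "u \<notin> set r" "y \<in> cyl A (r @ [u])"
proof -
  define k where "k = (LEAST m. y m = u)"
  have "y k = u" "\<And>i. i < k \<Longrightarrow> y i \<noteq> u"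
    unfolding k_def using LeastI_ex[OF assms(2)] not_less_Least by blast+
  then have "u \<notin> y ` {0..<k}"
    by fastforce
  with \<open>y k = u\<close> show ?thesis
    using assms(1) by (intro that[of "prefix k y"]) (simp_all add: cyl_iff)
qed

section \<open>Walks\<close>

text \<open>
  The word \<open>w\<close> followed by the letter \<open>t\<close> is admissible and starts with \<open>s\<close>; the final letter \<open>t\<close>
  is not part of \<open>w\<close>, so walks are composed by concatenation and the empty word is a walk from
  \<open>s\<close> to \<open>s\<close>.
\<close>

definition walk :: "('s \<Rightarrow> 's \<Rightarrow> bool) \<Rightarrow> 's \<Rightarrow> 's list \<Rightarrow> 's \<Rightarrow> bool" where
  "walk A s w t \<longleftrightarrow> hd (w @ [t]) = s \<and> successively A (w @ [t])"

lemma walk_Nil [simp]: "walk A s [] t \<longleftrightarrow> s = t"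
  by (auto simp: walk_def)

lemma walk_Cons: "walk A s (r # w) t \<longleftrightarrow> s = r \<and> A s (hd (w @ [t])) \<and> walk A (hd (w @ [t])) w t"
  by (auto simp: walk_def successively_Cons)

lemma walk_append_iff: "walk A s (v @ w) t \<longleftrightarrow> walk A s v (hd (w @ [t])) \<and> walk A (hd (w @ [t])) w t"
proof (induction v arbitrary: s)
  case Nil
  show ?case by (auto simp: walk_def)
next
  case (Cons r v)
  have "hd ((v @ w) @ [t]) = hd (v @ [hd (w @ [t])])"
    by (cases v) auto
  then show ?case
    unfolding append_Cons walk_Cons Cons.IH by auto
qed

lemma walk_append:
  assumes "walk A s v r" "walk A r w t"
  shows "walk A s (v @ w) t"
proof -
  have "hd (w @ [t]) = r"
    using assms(2) by (simp add: walk_def)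
  then show ?thesis
    using assms by (simp only: walk_append_iff)
qed

lemma conc_in_tms_walk: "w \<frown> y \<in> tms A \<longleftrightarrow> y \<in> tms A \<and> walk A (hd (w @ [y 0])) w (y 0)"
  by (simp add: conc_in_tms walk_def)

lemma walk_prefix:
  assumes "x \<in> tms A"
  shows "walk A (x 0) (prefix n x) (x n)"
proof -
  have "prefix n x \<frown> suffix n x \<in> tms A"
    using assms by (simp flip: prefix_suffix)
  moreover have "hd (prefix n x @ [x n]) = x 0"
    by (cases n) (auto simp: hd_append hd_conv_nth)
  ultimately show ?thesis
    unfolding conc_in_tms_walk by simp
qed

lemma prepend_subset_cyl_walk:
  assumes "walk A s w t" "B \<subseteq> cyl A [t]"
  shows "prepend A w B \<subseteq> cyl A [s]"
proof
  fix x assume "x \<in> prepend A w B"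
  then obtain y where "x = w \<frown> y" "y \<in> B" "w \<frown> y \<in> tms A"
    by (elim prependE)
  with assms show "x \<in> cyl A [s]"
    by (auto simp: cyl_single_iff conc_nth_0 walk_def subset_iff)
qed

lemma prepend_empty_if_not_walk:
  assumes "B \<subseteq> cyl A [t]" "\<not> walk A (hd (w @ [t])) w t"
  shows "prepend A w B = {}"
  using assms by (auto elim!: prependE simp: conc_in_tms_walk cyl_single_iff subset_iff)

lemma conc_in_tms_if_walk:
  assumes "walk A s w t" "y \<in> cyl A [t]"
  shows "w \<frown> y \<in> tms A" "(w \<frown> y) 0 = s"
  using assms by (auto simp: conc_in_tms cyl_single_iff walk_def conc_nth_0)

lemma prepend_eq_empty_iff:
  assumes "walk A s w t" "B \<subseteq> cyl A [t]"
  shows "prepend A w B = {} \<longleftrightarrow> B = {}"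
proof -
  have "w \<frown> y \<in> prepend A w B" if "y \<in> B" for y
    using conc_in_tms_if_walk[OF assms(1)] that assms(2) by auto
  moreover have "B \<noteq> {}" if "prepend A w B \<noteq> {}"
    using that by (auto simp: prepend_def)
  ultimately show ?thesis by blast
qed

section \<open>The Borel structure\<close>

lemma openin_cyl: "w \<noteq> [] \<Longrightarrow> openin (tms_topology A) (cyl A w)"
  by (auto simp: tms_topology_def intro!: topology_generated_by_Basis)

lemma openin_tms_cyl:
  assumes "openin (tms_topology A) V" "x \<in> V"
  shows "\<exists>n. cyl A (prefix (Suc n) x) \<subseteq> V"
proof -
  have "generate_topology_on {cyl A w | w. w \<noteq> []} V"
    using assms(1) by (simp add: tms_topology_def openin_topology_generated_by_iff)
  then have "\<forall>x\<in>V. \<exists>n. cyl A (prefix (Suc n) x) \<subseteq> V"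
  proof induction
    case (Int a b)
    show ?case
    proof
      fix x assume "x \<in> a \<inter> b"
      then obtain m n where mn: "cyl A (prefix (Suc m) x) \<subseteq> a" "cyl A (prefix (Suc n) x) \<subseteq> b"
        using Int.IH by blast
      have "cyl A (prefix (Suc (max m n)) x) \<subseteq> cyl A (prefix (Suc m) x) \<inter> cyl A (prefix (Suc n) x)"
        by (auto simp: cyl_def simp del: subseq_to_Suc)
      then show "\<exists>n. cyl A (prefix (Suc n) x) \<subseteq> a \<inter> b"
        using mn by blast
    qed
  next
    case (UN K)
    then show ?case by blast
  next
    case (Basis s)
    then obtain w where w: "s = cyl A w" "w \<noteq> []" by auto
    have "prefix (Suc (length w - 1)) x = w" if "x \<in> s" for x
      using that w by (simp add: cyl_iff del: subseq_to_Suc)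
    then show ?case using w by (metis order_refl)
  qed auto
  then show ?thesis using assms(2) by blast
qed

lemma openin_tms_subset: "openin (tms_topology A) V \<Longrightarrow> V \<subseteq> tms A"
  using openin_subset[of "tms_topology A" V]
  by (auto simp: tms_topology_def cyl_def)

lemma topspace_tms: "topspace (tms_topology A) = tms A"
proof
  show "topspace (tms_topology A) \<subseteq> tms A"
    using openin_tms_subset by blast
  show "tms A \<subseteq> topspace (tms_topology A)"
    using openin_subset[OF openin_cyl, of _ A] cyl_prefix[of _ A "Suc 0"] by fastforce
qed

lemma space_tms_borel [simp]: "space (tms_borel A) = tms A"
  unfolding tms_borel_def by (rule space_measure_of) (use openin_tms_subset in blast)

lemma sets_openin: "openin (tms_topology A) V \<Longrightarrow> V \<in> sets (tms_borel A)"
  using openin_tms_subset[of A] unfolding tms_borel_def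
  by (subst sets_measure_of) (auto intro: sigma_sets.Basic)

lemma sets_tms_borel:
  fixes A :: "'s :: countable \<Rightarrow> 's \<Rightarrow> bool"
  shows "sets (tms_borel A) = sigma_sets (tms A) (range (cyl A))"
proof -
  have "sets (tms_borel A) = sigma_sets (tms A) {V. openin (tms_topology A) V}"
    unfolding tms_borel_def by (rule sets_measure_of) (use openin_tms_subset in blast)
  also have "\<dots> = sigma_sets (tms A) (range (cyl A))"
  proof (rule sigma_sets_eqI)
    fix V assume "V \<in> {V. openin (tms_topology A) V}"
    then have V: "openin (tms_topology A) V" by simp
    have "V = (\<Union>w\<in>{w. w \<noteq> [] \<and> cyl A w \<subseteq> V}. cyl A w)"
    proof (intro equalityI subsetI)
      fix x assume x: "x \<in> V"
      obtain n where n: "cyl A (prefix (Suc n) x) \<subseteq> V"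
        using openin_tms_cyl[OF V x] by blast
      have "x \<in> cyl A (prefix (Suc n) x)"
        using cyl_prefix openin_tms_subset[OF V] x by blast
      with n show "x \<in> (\<Union>w\<in>{w. w \<noteq> [] \<and> cyl A w \<subseteq> V}. cyl A w)"
        by (intro UN_I[of "prefix (Suc n) x"]) (auto simp del: subseq_to_Suc)
    qed auto
    also have "\<dots> \<in> sigma_sets (tms A) (range (cyl A))"
      by (rule sigma_sets_UNION) (auto intro: sigma_sets.Basic countable_subset[OF _ countableI_type])
    finally show "V \<in> sigma_sets (tms A) (range (cyl A))" .
  next
    fix C assume "C \<in> range (cyl A)"
    then obtain w where w: "C = cyl A w" by auto
    show "C \<in> sigma_sets (tms A) {V. openin (tms_topology A) V}"
    proof (cases "w = []")
      case True
      then show ?thesis using w sigma_sets_top by simp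
    qed (use w openin_cyl in blast)
  qed
  finally show ?thesis .
qed

lemma Int_stable_cyl: "Int_stable (insert {} (range (cyl A)))"
proof -
  have "cyl A v \<inter> cyl A w \<in> insert {} (range (cyl A))" for v w
  proof (cases "cyl A v \<inter> cyl A w = {}")
    case False
    then obtain x where "x \<in> cyl A v" "x \<in> cyl A w" by auto
    then have "v ! i = x i" if "i < length v" for i
      using that by (auto simp: cyl_def)
    moreover have "w ! i = x i" if "i < length w" for i
      using that \<open>x \<in> cyl A w\<close> by (auto simp: cyl_def)
    ultimately have "cyl A v \<inter> cyl A w = cyl A (prefix (max (length v) (length w)) x)"
      by (auto simp: cyl_def less_max_iff_disj)
    then show ?thesis by simp
  qed simp
  then show ?thesis
    unfolding Int_stable_def by auto
qed

lemma measurable_tms_borel: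
  fixes A :: "'s :: countable \<Rightarrow> 's \<Rightarrow> bool"
  assumes "\<And>x. x \<in> space M \<Longrightarrow> f x \<in> tms A"
    and "\<And>i s. {x \<in> space M. f x i = s} \<in> sets M"
  shows "f \<in> measurable M (tms_borel A)"
proof (rule measurable_sigma_sets[OF sets_tms_borel])
  fix C assume "C \<in> range (cyl A)"
  then obtain w where w: "C = cyl A w" by auto
  have "f -` C \<inter> space M = {x \<in> space M. \<forall>i\<in>{..<length w}. f x i = w ! i}"
    using assms(1) by (auto simp: w cyl_def)
  also have "\<dots> \<in> sets M"
    by (rule sets.sets_Collect_finite_All) (use assms(2) in auto)
  finally show "f -` C \<inter> space M \<in> sets M" .
qed (use assms(1) in \<open>auto simp: cyl_def\<close>)

lemma
  fixes A :: "'s :: countable \<Rightarrow> 's \<Rightarrow> bool"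
  shows sets_eval_eq: "{x \<in> tms A. x i = s} \<in> sets (tms_borel A)"
    and sets_cyl [simp]: "cyl A w \<in> sets (tms_borel A)"
proof -
  show cyl: "cyl A w \<in> sets (tms_borel A)" for w
    by (simp add: sets_tms_borel)
  show eval: "{x \<in> tms A. x i = s} \<in> sets (tms_borel A)" for i s
  proof -
    have "{x \<in> tms A. x i = s} = (\<Union>w\<in>{w. length w = Suc i \<and> w ! i = s}. cyl A w)"
    proof (intro equalityI subsetI)
      fix x assume "x \<in> {x \<in> tms A. x i = s}"
      then show "x \<in> (\<Union>w\<in>{w. length w = Suc i \<and> w ! i = s}. cyl A w)"
        by (intro UN_I[of "prefix (Suc i) x"]) (auto simp: cyl_iff simp del: subseq_to_Suc)
    qed (auto simp: cyl_def)
    also have "\<dots> \<in> sets (tms_borel A)"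
      by (intro sets.countable_UN') (auto intro: cyl countable_subset[OF _ countableI_type])
    finally show ?thesis .
  qed
qed

lemma measurable_suffix:
  fixes A :: "'s :: countable \<Rightarrow> 's \<Rightarrow> bool"
  shows "suffix n \<in> measurable (tms_borel A) (tms_borel A)"
  by (rule measurable_tms_borel) (auto simp: suffix_in_tms sets_eval_eq)

lemma sets_prepend [simp]:
  fixes A :: "'s :: countable \<Rightarrow> 's \<Rightarrow> bool"
  assumes "B \<in> sets (tms_borel A)"
  shows "prepend A w B \<in> sets (tms_borel A)"
proof -
  have "prepend A w B = cyl A w \<inter> (suffix (length w) -` B \<inter> space (tms_borel A))"
    by (auto simp: prepend_def cyl_def)
  also have "\<dots> \<in> sets (tms_borel A)"
    by (intro sets.Int measurable_sets[OF measurable_suffix] assms sets_cyl)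
  finally show ?thesis .
qed

lemma measurable_conc_suffix:
  fixes A :: "'s :: countable \<Rightarrow> 's \<Rightarrow> bool"
  assumes "\<And>x. x \<in> C \<Longrightarrow> w \<frown> suffix n x \<in> tms A"
  shows "(\<lambda>x. w \<frown> suffix n x) \<in> measurable (restrict_space (tms_borel A) C) (tms_borel A)"
proof (rule measurable_tms_borel)
  fix i s
  let ?S = "space (restrict_space (tms_borel A) C)"
  show "{x \<in> ?S. (w \<frown> suffix n x) i = s} \<in> sets (restrict_space (tms_borel A) C)"
  proof (cases "i < length w")
    case False
    have "{x \<in> tms A. x (n + (i - length w)) = s} \<inter> C \<in> sets (restrict_space (tms_borel A) C)"
      unfolding sets_restrict_space Int_commute[of _ C] by (intro imageI sets_eval_eq)
    also have "{x \<in> tms A. x (n + (i - length w)) = s} \<inter> C = {x \<in> ?S. (w \<frown> suffix n x) i = s}"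
      using False by (auto simp: space_restrict_space)
    finally show ?thesis .
  next
    case True
    have "{x \<in> ?S. (w \<frown> suffix n x) i = s} = (if w ! i = s then ?S else {})"
      using True by auto
    then show ?thesis
      by (cases "w ! i = s") (simp_all only: if_True if_False refl sets.top sets.empty_sets)
  qed
qed (use assms in \<open>auto simp: space_restrict_space\<close>)

lemma sets_pull [simp]:
  fixes A :: "'s :: countable \<Rightarrow> 's \<Rightarrow> bool"
  assumes "B \<in> sets (tms_borel A)"
  shows "pull A w B \<in> sets (tms_borel A)"
proof -
  define C where "C = {y \<in> tms A. w \<frown> y \<in> tms A}"
  have C: "C \<in> sets (tms_borel A)"
  proof -
    have "C = (\<Union>t\<in>{t. successively A (w @ [t])}. cyl A [t])"
      by (auto simp: C_def conc_in_tms cyl_single_iff)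
    also have "\<dots> \<in> sets (tms_borel A)"
      by (intro sets.countable_UN') (auto intro: countable_subset[OF _ countableI_type])
    finally show ?thesis .
  qed
  have "(\<frown>) w -` B \<inter> space (restrict_space (tms_borel A) C) \<in> sets (restrict_space (tms_borel A) C)"
    using measurable_sets[OF measurable_conc_suffix assms, of C w 0] by (auto simp: C_def)
  moreover have "(\<frown>) w -` B \<inter> space (restrict_space (tms_borel A) C) = pull A w B"
    using sets.sets_into_space[OF assms] by (auto simp: space_restrict_space C_def pull_def)
  moreover have "C \<inter> space (tms_borel A) \<in> sets (tms_borel A)"
    by (intro sets.Int C sets.top)
  ultimately show ?thesis
    by (simp add: sets_restrict_space_iff)
qed

section \<open>Extension of homomorphisms into the reals\<close>

text \<open>Natural multiples in an abelian group.\<close>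

definition multiple :: "nat \<Rightarrow> 'g::ab_group_add \<Rightarrow> 'g" where
  "multiple n x = (\<Sum>i<n. x)"

lemma multiple_0 [simp]: "multiple 0 x = 0"
  and multiple_Suc: "multiple (Suc n) x = multiple n x + x"
  by (simp_all add: multiple_def)

lemma multiple_add: "multiple (m + n) x = multiple m x + multiple n x"
  by (induction n) (simp_all add: multiple_Suc algebra_simps)

lemma multiple_mult: "multiple (m * n) x = multiple m (multiple n x)"
  by (induction m) (simp_all add: multiple_Suc multiple_add algebra_simps)

lemma multiple_diff: "multiple n (x - y) = multiple n x - multiple n y"
  by (induction n) (simp_all add: multiple_Suc algebra_simps)

lemma multiple_Pair: "multiple n (x, r :: real) = (multiple n x, real n * r)"
  by (induction n) (simp_all add: multiple_Suc zero_prod_def algebra_simps)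

lemma add_subgroup_diff: "add_subgroup F \<Longrightarrow> x \<in> F \<Longrightarrow> y \<in> F \<Longrightarrow> x - y \<in> F"
  unfolding add_subgroup_def by (metis diff_conv_add_uminus)

lemma add_subgroup_multiple: "add_subgroup F \<Longrightarrow> x \<in> F \<Longrightarrow> multiple n x \<in> F"
  by (induction n) (auto simp: multiple_Suc add_subgroup_def)

text \<open>
  One step of the extension: the subgroup \<open>G\<close> is the graph of a homomorphism defined on a subgroup,
  and the value of the extension at \<open>x\<close> is forced as soon as some positive multiple of \<open>x\<close> lies
  in the domain; division by this multiple is possible in the reals.
\<close>

lemma additive_graph_extend:
  fixes G :: "('g::ab_group_add \<times> real) set"
  assumes G: "add_subgroup G" and fn: "\<And>r. (0, r) \<in> G \<Longrightarrow> r = 0"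
  obtains G' c where "add_subgroup G'" "\<And>r. (0, r) \<in> G' \<Longrightarrow> r = 0" "G \<subseteq> G'" "(x, c) \<in> G'"
proof -
  have add: "(y + y', r + r') \<in> G" if "(y, r) \<in> G" "(y', r') \<in> G" for y y' r r'
    using G that unfolding add_subgroup_def by (metis add_Pair)
  have neg: "(- y, - r) \<in> G" if "(y, r) \<in> G" for y r
    using G that unfolding add_subgroup_def by (metis uminus_Pair)
  have zero: "(0, 0) \<in> G"
    using G unfolding add_subgroup_def zero_prod_def by blast
  have diff: "(y - y', r - r') \<in> G" if "(y, r) \<in> G" "(y', r') \<in> G" for y y' r r'
    using add[OF that(1) neg[OF that(2)]] by simp
  have mult: "(multiple n y, real n * r) \<in> G" if "(y, r) \<in> G" for n y r
    using add_subgroup_multiple[OF G that, of n] by (simp add: multiple_Pair)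
  define Z where "Z m n = multiple m x - multiple n x" for m n
  have Z_add: "Z m n + Z m' n' = Z (m + m') (n + n')" for m n m' n'
    by (simp add: Z_def multiple_add)
  have Z_neg: "- Z m n = Z n m" for m n
    by (simp add: Z_def)
  have "\<exists>c. \<forall>m n r. (Z m n, r) \<in> G \<longrightarrow> r = (real m - real n) * c"
  proof (cases "\<exists>d r. d > 0 \<and> (multiple d x, r) \<in> G")
    case True
    then obtain d r where d: "d > 0" "(multiple d x, r) \<in> G" by blast
    have "r' = (real m - real n) * (r / real d)" if "(Z m n, r') \<in> G" for m n r'
    proof -
      have "(multiple d (Z m n), real d * r') \<in> G"
        using that by (rule mult)
      moreover have "(Z (m * d) (n * d), real m * r - real n * r) \<in> G"
        using diff[OF mult[OF d(2), of m] mult[OF d(2), of n]] by (simp add: Z_def multiple_mult)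
      moreover have "multiple d (Z m n) = Z (m * d) (n * d)"
        by (simp add: Z_def multiple_diff mult.commute[of _ d] multiple_mult)
      ultimately have "real d * r' - (real m * r - real n * r) = 0"
        using diff fn by fastforce
      then show ?thesis
        using d(1) by (simp add: field_simps)
    qed
    then show ?thesis by blast
  next
    case False
    have "r = 0" if "(Z m n, r) \<in> G" for m n r
    proof (cases m n rule: linorder_cases)
      case less
      then have "Z m n = - multiple (n - m) x"
        using multiple_add[of m "n - m" x] by (simp add: Z_def)
      then have "(multiple (n - m) x, - r) \<in> G"
        using neg[OF that] by simp
      then show ?thesis using False less zero_less_diff by blast
    next
      case equal
      then show ?thesis using that fn by (simp add: Z_def)
    next
      case greater
      then have "Z m n = multiple (m - n) x"
        using multiple_add[of n "m - n" x] by (simp add: Z_def)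
      then show ?thesis using False greater that zero_less_diff by metis
    qed
    then show ?thesis by (intro exI[of _ 0]) auto
  qed
  then obtain c where c: "\<And>m n r. (Z m n, r) \<in> G \<Longrightarrow> r = (real m - real n) * c"
    by blast
  define G' where "G' = {(y + Z m n, r + (real m - real n) * c) | y m n r. (y, r) \<in> G}"
  show ?thesis
  proof (rule that)
    have "(0, 0) \<in> G'"
      unfolding G'_def using zero by (intro CollectI exI[of _ 0]) (auto simp: Z_def)
    moreover have "(p + p', q + q') \<in> G'" if "(p, q) \<in> G'" "(p', q') \<in> G'" for p p' q q'
    proof -
      from that(1) obtain y m n r where 1: "p = y + Z m n" "q = r + (real m - real n) * c" "(y, r) \<in> G"
        unfolding G'_def by blast
      from that(2) obtain y' m' n' r' where 2: "p' = y' + Z m' n'" "q' = r' + (real m' - real n') * c"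
          "(y', r') \<in> G"
        unfolding G'_def by blast
      have "p + p' = (y + y') + Z (m + m') (n + n')"
        unfolding 1 2 Z_add[symmetric] by (simp add: algebra_simps)
      moreover have "q + q' = (r + r') + (real (m + m') - real (n + n')) * c"
        unfolding 1 2 by (simp add: algebra_simps)
      ultimately show ?thesis
        unfolding G'_def using add[OF 1(3) 2(3)] by blast
    qed
    moreover have "(- p, - q) \<in> G'" if pq: "(p, q) \<in> G'" for p q
    proof -
      from pq obtain y m n r where 1: "p = y + Z m n" "q = r + (real m - real n) * c" "(y, r) \<in> G"
        unfolding G'_def by blast
      have "- p = - y + Z n m"
        unfolding 1(1) using Z_neg[of m n] by simp
      moreover have "- q = - r + (real n - real m) * c"
        unfolding 1 by (simp add: algebra_simps)
      ultimately show ?thesis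
        unfolding G'_def using neg[OF 1(3)] by blast
    qed
    ultimately show "add_subgroup G'"
      unfolding add_subgroup_def by (auto simp: zero_prod_def)
    show "q = 0" if q: "(0, q) \<in> G'" for q
    proof -
      from q obtain y m n r where 1: "0 = y + Z m n" "q = r + (real m - real n) * c" "(y, r) \<in> G"
        unfolding G'_def by blast
      have "- y = Z m n"
        using 1(1) by (metis add_eq_0_iff)
      then have "(Z m n, - r) \<in> G"
        using neg[OF 1(3)] by simp
      then show ?thesis
        using c 1(2) by fastforce
    qed
    show "G \<subseteq> G'"
    proof
      fix p assume "p \<in> G"
      then show "p \<in> G'"
        unfolding G'_def
        by (intro CollectI exI[of _ "fst p"] exI[of _ 0] exI[of _ "snd p"]) (auto simp: Z_def)
    qed
    show "(x, c) \<in> G'"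
      unfolding G'_def
      by (intro CollectI exI[of _ 0] exI[of _ 1]) (use zero in \<open>auto simp: Z_def multiple_Suc\<close>)
  qed
qed

text \<open>A maximal graph, given by Zorn's lemma, is defined everywhere.\<close>

lemma additive_graph_total:
  fixes G :: "('g::ab_group_add \<times> real) set"
  assumes G: "add_subgroup G" and fn: "\<And>r. (0, r) \<in> G \<Longrightarrow> r = 0"
  obtains h where "Modules.additive h" "\<And>x r. (x, r) \<in> G \<Longrightarrow> h x = r"
proof -
  define \<A> where "\<A> = {K. add_subgroup K \<and> (\<forall>r. (0, r) \<in> K \<longrightarrow> r = 0) \<and> G \<subseteq> K}"
  have "\<exists>M\<in>\<A>. \<forall>X\<in>\<A>. M \<subseteq> X \<longrightarrow> X = M"
  proof (rule subset_Zorn_nonempty)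
    show "\<A> \<noteq> {}" using G fn by (auto simp: \<A>_def)
    fix C assume C: "C \<noteq> {}" "subset.chain \<A> C"
    then have sub: "C \<subseteq> \<A>" and lin: "\<And>X Y. X \<in> C \<Longrightarrow> Y \<in> C \<Longrightarrow> X \<subseteq> Y \<or> Y \<subseteq> X"
      by (auto simp: subset_chain_def)
    have sg: "add_subgroup X" if "X \<in> C" for X
      using that sub by (auto simp: \<A>_def)
    have "0 \<in> \<Union>C"
      using C(1) sg by (auto simp: add_subgroup_def)
    moreover have "p + q \<in> \<Union>C" if pq: "p \<in> \<Union>C" "q \<in> \<Union>C" for p q
    proof -
      obtain X Y where XY: "X \<in> C" "p \<in> X" "Y \<in> C" "q \<in> Y"
        using pq by auto
      with lin[of X Y] obtain W where "W \<in> C" "p \<in> W" "q \<in> W"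
        by blast
      then show ?thesis
        using sg[of W] by (auto simp: add_subgroup_def)
    qed
    moreover have "- p \<in> \<Union>C" if "p \<in> \<Union>C" for p
      using that sg unfolding add_subgroup_def by blast
    ultimately have "add_subgroup (\<Union>C)"
      unfolding add_subgroup_def by blast
    then show "\<Union>C \<in> \<A>"
      using sub C(1) unfolding \<A>_def by blast
  qed
  then obtain M where M: "M \<in> \<A>" and max: "\<And>X. X \<in> \<A> \<Longrightarrow> M \<subseteq> X \<Longrightarrow> X = M"
    by blast
  have sgM: "add_subgroup M" and fnM: "\<And>r. (0, r) \<in> M \<Longrightarrow> r = 0" and GM: "G \<subseteq> M"
    using M by (auto simp: \<A>_def)
  have "\<exists>r. (x, r) \<in> M" for x
  proof -
    obtain M' c where M': "add_subgroup M'" "\<And>r. (0, r) \<in> M' \<Longrightarrow> r = 0" "M \<subseteq> M'" "(x, c) \<in> M'"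
      using additive_graph_extend[OF sgM fnM] by blast
    then have "M' \<in> \<A>"
      using GM by (auto simp: \<A>_def)
    with max M'(3,4) show ?thesis by blast
  qed
  then obtain h where h: "\<And>x. (x, h x) \<in> M" by metis
  have unique: "r = r'" if "(x, r) \<in> M" "(x, r') \<in> M" for x r r'
    using add_subgroup_diff[OF sgM that] fnM[of "r - r'"] by simp
  have "h (x + y) = h x + h y" for x y
  proof -
    have "(x, h x) + (y, h y) \<in> M"
      using sgM h unfolding add_subgroup_def by blast
    then show ?thesis
      using unique[OF h] by simp
  qed
  then have "Modules.additive h"
    by (simp add: Modules.additive_def)
  moreover have "h x = r" if "(x, r) \<in> G" for x r
    using unique[OF h] that GM by blast
  ultimately show ?thesis
    using that by blast
qed

text \<open>
  A real-valued homomorphism on a submonoid of an abelian group, given by its graph \<open>P\<close>, extends to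
  the group: first to the subgroup of the differences, and from there by divisibility of the reals.
\<close>

lemma additive_extension_from_submonoid:
  fixes P :: "('g::ab_group_add \<times> real) set"
  assumes zero: "0 \<in> P" and add: "\<And>p q. p \<in> P \<Longrightarrow> q \<in> P \<Longrightarrow> p + q \<in> P"
    and fn: "\<And>x r s. (x, r) \<in> P \<Longrightarrow> (x, s) \<in> P \<Longrightarrow> r = s"
  obtains h where "Modules.additive h" "\<And>x r. (x, r) \<in> P \<Longrightarrow> h x = r"
proof -
  define G where "G = {p - q | p q. p \<in> P \<and> q \<in> P}"
  have "0 \<in> G"
    unfolding G_def using zero by (intro CollectI exI[of _ 0]) simp
  moreover have "x + y \<in> G" if "x \<in> G" "y \<in> G" for x y
  proof -
    from that obtain p q p' q' where "x = p - q" "y = p' - q'" "p \<in> P" "q \<in> P" "p' \<in> P" "q' \<in> P"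
      unfolding G_def by blast
    moreover from this have "x + y = (p + p') - (q + q')" by simp
    ultimately show ?thesis
      unfolding G_def using add by blast
  qed
  moreover have "- x \<in> G" if "x \<in> G" for x
  proof -
    from that obtain p q where "x = p - q" "p \<in> P" "q \<in> P"
      unfolding G_def by blast
    then show ?thesis
      unfolding G_def by (intro CollectI exI[of _ q] exI[of _ p]) simp
  qed
  ultimately have "add_subgroup G"
    unfolding add_subgroup_def by blast
  moreover have "r = 0" if "(0, r) \<in> G" for r
  proof -
    from that obtain p q where pq: "(0, r) = p - q" "p \<in> P" "q \<in> P"
      unfolding G_def by blast
    then have "fst p = fst q" "snd p - snd q = r"
      by (metis fst_conv fst_diff right_minus_eq, metis snd_conv snd_diff)
    moreover from this pq have "snd p = snd q"
      using fn[of "fst p" "snd p" "snd q"] by (metis prod.collapse)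
    ultimately show ?thesis by simp
  qed
  ultimately obtain h where h: "Modules.additive h" "\<And>x r. (x, r) \<in> G \<Longrightarrow> h x = r"
    using additive_graph_total by blast
  have "P \<subseteq> G"
  proof
    fix p assume "p \<in> P"
    then show "p \<in> G"
      unfolding G_def using zero by (intro CollectI exI[of _ p] exI[of _ 0]) simp
  qed
  with h show ?thesis
    using that by blast
qed

section \<open>Countable Polish groups are discrete\<close>

text \<open>By the Baire category theorem some point of the group is isolated.\<close>

lemma open_singleton_countable_polish_group:
  fixes x :: "'g::{topological_ab_group_add, polish_space}"
  assumes "countable (UNIV :: 'g set)"
  shows "open {x}"
proof -
  have "\<exists>x0::'g. open {x0}"
  proof (rule ccontr)
    assume no: "\<not> (\<exists>x0::'g. open {x0})"
    have empty: "interior {y} = {}" for y :: 'g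
      using no interior_subset[of "{y}"] open_interior[of "{y}"] by (metis subset_singletonD)
    have "Met_TC.mtopology interior_of \<Union>(range (\<lambda>y::'g. {y})) = {}"
    proof (rule Met_TC.metric_Baire_category_alt)
      show "Met_TC.mcomplete TYPE('g)"
        by (simp add: complete_UNIV)
      show "countable (range (\<lambda>y::'g. {y}))"
        using assms by blast
      show "closedin Met_TC.mtopology T \<and> Met_TC.mtopology interior_of T = {}"
        if "T \<in> range (\<lambda>y::'g. {y})" for T
        using that empty by auto
    qed
    then show False by simp
  qed
  \<comment> \<open>Translations are homeomorphisms.\<close>
  then obtain x0 :: 'g where "open {x0}" ..
  then have "open ((\<lambda>y. y - x + x0) -` {x0})"
    by (rule open_vimage) (intro continuous_intros)
  also have "(\<lambda>y. y - x + x0) -` {x0} = {x}"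
    by auto
  finally show ?thesis .
qed

lemma closure_of_countable_polish_group:
  fixes S H :: "'g::{topological_ab_group_add, polish_space} set"
  assumes "countable (UNIV :: 'g set)"
  shows "top_of_set H closure_of S = H \<inter> S"
proof -
  have "open V" for V :: "'g set"
    using open_UN[of V "\<lambda>x. {x}"] open_singleton_countable_polish_group[OF assms] by simp
  then have "closedin (top_of_set H) (H \<inter> S)"
    by (intro closedin_closed_Int) (simp add: closed_def)
  then have "top_of_set H closure_of (H \<inter> S) = H \<inter> S"
    by (simp add: closure_of_closedin)
  then show ?thesis
    using closure_of_restrict[of "top_of_set H" S] by simp
qed

section \<open>Sums along walks in a mixing shift\<close>

text \<open>
  The sum of a function of the states along a word; for a function of the first coordinate this is
  the Birkhoff sum over the time spent in the word.
\<close>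

definition word_sum :: "('s \<Rightarrow> 'g::monoid_add) \<Rightarrow> 's list \<Rightarrow> 'g" where
  "word_sum f w = sum_list (map f w)"

lemma word_sum_simps [simp]:
  "word_sum f [] = 0" "word_sum f (s # w) = f s + word_sum f w"
  "word_sum f (v @ w) = word_sum f v + word_sum f w"
  by (simp_all add: word_sum_def)

lemma birkhoff_sum_prefix:
  assumes "\<And>x. x \<in> tms A \<Longrightarrow> \<phi> x = f (x 0)" "x \<in> tms A"
  shows "birkhoff_sum \<phi> n x = word_sum f (prefix n x)"
proof (induction n)
  case (Suc n)
  have "\<phi> ((shift ^^ n) x) = f (x n)"
    using assms suffix_in_tms[OF assms(2), of n] by (simp add: shift_funpow)
  with Suc show ?case
    by (simp add: birkhoff_sum_def)
qed (simp add: birkhoff_sum_def)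

lemma group_closure_mono:
  assumes "S \<subseteq> T"
  shows "group_closure S \<subseteq> group_closure T"
proof
  fix x assume "x \<in> group_closure S"
  then show "x \<in> group_closure T"
    by induction (use assms in \<open>auto intro: group_closure.intros\<close>)
qed

text \<open>A mixing topological Markov shift in which every state occurs.\<close>

locale mixing_shift =
  fixes A :: "'s::countable \<Rightarrow> 's \<Rightarrow> bool"
  assumes cyl_nonempty: "\<And>s. cyl A [s] \<noteq> {}"
    and mix: "mixing A"
begin

lemma walks_eventually: "\<exists>N. \<forall>n\<ge>N. \<exists>w. walk A s w t \<and> length w = n"
proof -
  obtain N where N: "\<And>n. n \<ge> N \<Longrightarrow> cyl A [s] \<inter> {x \<in> tms A. (shift ^^ n) x \<in> cyl A [t]} \<noteq> {}"
    using mix unfolding mixing_def tms_partition_def by blast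
  have "\<exists>w. walk A s w t \<and> length w = n" if "n \<ge> N" for n
  proof -
    obtain x where x: "x \<in> cyl A [s]" "suffix n x \<in> cyl A [t]"
      using N[OF \<open>n \<ge> N\<close>] by (auto simp: shift_funpow)
    then have "walk A s (prefix n x) t"
      using walk_prefix[of x A n] by (simp add: cyl_single_iff)
    then show ?thesis
      by (intro exI[of _ "prefix n x"]) simp
  qed
  then show ?thesis by blast
qed

lemma walk_exists: obtains w where "walk A s w t"
  using walks_eventually[of s t] by blast

lemma walk_cyl_nonempty:
  assumes "walk A s w t"
  shows "cyl A (w @ [t]) \<noteq> {}"
  using prepend_eq_empty_iff[OF assms order_refl] cyl_nonempty[of t] by (simp add: prepend_cyl)

lemma walk_of_cyl_nonempty:
  assumes "cyl A (w @ [t]) \<noteq> {}"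
  shows "walk A (hd (w @ [t])) w t"
  using prepend_empty_if_not_walk[of "cyl A [t]" A t w] assms by (auto simp: prepend_cyl)

text \<open>
  The differences of the sums over two loops of equal length at a fixed state form a group. It
  contains the differences coming from periodic points: a loop at another state \<open>x\<close> is inserted into
  an excursion from the base state to \<open>x\<close>, and the same excursion without the loop is added to the
  other side.
\<close>

lemma loop_differences:
  fixes b :: "'s \<Rightarrow> 'g::ab_group_add"
  assumes "z \<in> group_closure {word_sum b X - word_sum b Y | X Y x y.
      walk A x X x \<and> walk A y Y y \<and> length X = length Y}"
  shows "\<exists>v w. walk A u v u \<and> walk A u w u \<and> length v = length w \<and> word_sum b v - word_sum b w = z"
  using assms
proof induction
  case (base z)
  show ?case
  proof (cases "z = 0")
    case True
    then show ?thesis by (intro exI[of _ "[]"]) simp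
  next
    case False
    with base obtain X Y x y where XY: "z = word_sum b X - word_sum b Y" "walk A x X x" "walk A y Y y"
        "length X = length Y"
      by blast
    obtain i where i: "walk A u i x" using walk_exists by blast
    obtain j where j: "walk A x j u" using walk_exists by blast
    obtain k where k: "walk A u k y" using walk_exists by blast
    obtain l where l: "walk A y l u" using walk_exists by blast
    have "walk A u (i @ X @ j @ k @ l) u" "walk A u (i @ j @ k @ Y @ l) u"
      by (intro walk_append[OF i] walk_append[OF j] walk_append[OF k] walk_append[OF XY(2)]
          walk_append[OF XY(3)] l)+
    moreover have "word_sum b (i @ X @ j @ k @ l) - word_sum b (i @ j @ k @ Y @ l) = z"
      by (simp add: XY(1) algebra_simps)
    moreover have "length (i @ X @ j @ k @ l) = length (i @ j @ k @ Y @ l)"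
      using XY(4) by simp
    ultimately show ?thesis by blast
  qed
next
  case (diff z z')
  obtain v w where 1: "walk A u v u" "walk A u w u" "length v = length w"
      "word_sum b v - word_sum b w = z"
    using diff.IH(1) by blast
  obtain v' w' where 2: "walk A u v' u" "walk A u w' u" "length v' = length w'"
      "word_sum b v' - word_sum b w' = z'"
    using diff.IH(2) by blast
  note * = 1 2
  have "walk A u (v @ w') u" "walk A u (w @ v') u"
    using * by (blast intro: walk_append)+
  moreover have "word_sum b (v @ w') - word_sum b (w @ v') = z - z'"
    using * by (auto simp: algebra_simps)
  moreover have "length (v @ w') = length (w @ v')"
    using * by simp
  ultimately show ?case by blast
qed

text \<open>The same with a prescribed difference of the lengths, by mixing.\<close>

lemma loop_differences_length:
  fixes b :: "'s \<Rightarrow> 'g::ab_group_add"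
  assumes F: "add_subgroup F" "\<And>s. b s \<in> F"
    and gen: "F \<subseteq> group_closure {word_sum b X - word_sum b Y | X Y x y.
      walk A x X x \<and> walk A y Y y \<and> length X = length Y}"
    and z: "z \<in> F"
  shows "\<exists>v w. walk A u v u \<and> walk A u w u \<and> length v = length w + k \<and> word_sum b v - word_sum b w = z"
proof -
  obtain N where N: "\<And>n. n \<ge> N \<Longrightarrow> \<exists>w. walk A u w u \<and> length w = n"
    using walks_eventually by blast
  obtain w1 where w1: "walk A u w1 u" "length w1 = N" using N[of N] by auto
  obtain v1 where v1: "walk A u v1 u" "length v1 = N + k" using N[of "N + k"] by auto
  have sum_F: "word_sum b w \<in> F" for w
    using F by (induction w) (auto simp: add_subgroup_def)
  have "z - (word_sum b v1 - word_sum b w1) \<in> F"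
    using z sum_F F(1) by (intro add_subgroup_diff) auto
  with gen loop_differences obtain v2 w2 where 2: "walk A u v2 u" "walk A u w2 u"
      "length v2 = length w2" "word_sum b v2 - word_sum b w2 = z - (word_sum b v1 - word_sum b w1)"
    by blast
  have "word_sum b (v1 @ v2) - word_sum b (w1 @ w2)
      = (word_sum b v1 - word_sum b w1) + (word_sum b v2 - word_sum b w2)"
    by simp
  also have "\<dots> = z"
    unfolding 2(4) by simp
  finally have "word_sum b (v1 @ v2) - word_sum b (w1 @ w2) = z" .
  moreover have "walk A u (v1 @ v2) u" "walk A u (w1 @ w2) u"
    using w1 v1 2 by (blast intro: walk_append)+
  moreover have "length (v1 @ v2) = length (w1 @ w2) + k"
    using w1 v1 2 by simp
  ultimately show ?thesis by blast
qed

end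

section \<open>Measure-theoretic preliminaries\<close>

lemma sum_measure_exists:
  fixes \<kappa> :: "'i \<Rightarrow> 'a measure"
  assumes sets: "\<And>i. sets (\<kappa> i) = sets M"
  obtains N where "sets N = sets M"
    "\<And>B. B \<in> sets M \<Longrightarrow> emeasure N B = (\<integral>\<^sup>+i. emeasure (\<kappa> i) B \<partial>count_space I)"
proof -
  define N where
    "N = measure_of (space M) (sets M) (\<lambda>B. \<integral>\<^sup>+i. emeasure (\<kappa> i) B \<partial>count_space I)"
  have "countably_additive (sets M) (\<lambda>B. \<integral>\<^sup>+i. emeasure (\<kappa> i) B \<partial>count_space I)"
  proof (rule countably_additiveI)
    fix D :: "nat \<Rightarrow> 'a set" assume D: "range D \<subseteq> sets M" "disjoint_family D" "(\<Union>i. D i) \<in> sets M"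
    have "(\<Sum>n. \<integral>\<^sup>+i. emeasure (\<kappa> i) (D n) \<partial>count_space I)
        = (\<integral>\<^sup>+i. (\<Sum>n. emeasure (\<kappa> i) (D n)) \<partial>count_space I)"
      by (rule nn_integral_suminf[symmetric]) simp
    also have "\<dots> = (\<integral>\<^sup>+i. emeasure (\<kappa> i) (\<Union>n. D n) \<partial>count_space I)"
      using D by (intro nn_integral_cong suminf_emeasure) (auto simp: sets)
    finally show "(\<Sum>n. \<integral>\<^sup>+i. emeasure (\<kappa> i) (D n) \<partial>count_space I)
        = (\<integral>\<^sup>+i. emeasure (\<kappa> i) (\<Union>n. D n) \<partial>count_space I)" .
  qed
  then have "emeasure N B = (\<integral>\<^sup>+i. emeasure (\<kappa> i) B \<partial>count_space I)" if "B \<in> sets M" for B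
    unfolding N_def using that
    by (intro emeasure_measure_of_sigma sets.sigma_algebra_axioms) (auto simp: positive_def)
  moreover have "sets N = sets M"
    unfolding N_def by simp
  ultimately show ?thesis
    using that by blast
qed

text \<open>
  The constant is the supremum of the \<open>c\<close> that lie almost everywhere below \<open>f\<close> on \<open>S\<close>. If \<open>S\<close> is
  negligible, it is infinite.
\<close>

lemma AE_constant_if_level_sets_trivial:
  fixes f :: "'a \<Rightarrow> ennreal"
  assumes "\<And>c. (AE x in M. x \<in> S \<longrightarrow> c < f x) \<or> (AE x in M. x \<in> S \<longrightarrow> f x \<le> c)"
  obtains c where "AE x in M. x \<in> S \<longrightarrow> f x = c"
proof -
  define L where "L = {c. AE x in M. x \<in> S \<longrightarrow> c < f x}"
  define U where "U = {c. AE x in M. x \<in> S \<longrightarrow> f x \<le> c}"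
  have lower: "AE x in M. x \<in> S \<longrightarrow> Sup L \<le> f x"
  proof (cases "L = {}")
    case False
    then obtain c :: "nat \<Rightarrow> ennreal" where c: "range c \<subseteq> L" "Sup L = (SUP i. c i)"
      using ennreal_Sup_countable_SUP by blast
    then have "AE x in M. \<forall>i. x \<in> S \<longrightarrow> c i < f x"
      by (subst AE_all_countable) (auto simp: L_def)
    then show ?thesis
      by eventually_elim (auto simp: c(2) less_imp_le intro!: SUP_least)
  qed (simp add: bot_ennreal)
  have "top \<in> U"
    by (simp add: U_def)
  then obtain d :: "nat \<Rightarrow> ennreal" where d: "range d \<subseteq> U" "Inf U = (INF i. d i)"
    using ennreal_Inf_countable_INF by blast
  then have "AE x in M. \<forall>i. x \<in> S \<longrightarrow> f x \<le> d i"
    by (subst AE_all_countable) (auto simp: U_def)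
  then have upper: "AE x in M. x \<in> S \<longrightarrow> f x \<le> Inf U"
    by eventually_elim (auto simp: d(2) intro!: INF_greatest)
  have "Inf U \<le> Sup L"
  proof (rule ccontr)
    assume "\<not> Inf U \<le> Sup L"
    then obtain c where c: "Sup L < c" "c < Inf U"
      using dense by (auto simp: not_le)
    then have "c \<notin> L" "c \<notin> U"
      using Sup_upper[of c L] Inf_lower[of c U] by (auto simp: not_le)
    with assms[of c] show False
      by (auto simp: L_def U_def)
  qed
  with lower upper have "AE x in M. x \<in> S \<longrightarrow> f x = Sup L"
    by (auto elim!: eventually_elim2)
  then show ?thesis
    using that by blast
qed

lemma has_sum_of_nn_integral:
  fixes p :: "'a \<Rightarrow> real"
  assumes "\<And>t. p t \<ge> 0" "(\<integral>\<^sup>+t. ennreal (p t) \<partial>count_space UNIV) = ennreal c" "c \<ge> 0"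
  shows "(p has_sum c) UNIV"
proof -
  have "integrable (count_space UNIV) p"
    by (rule integrableI_nonneg) (use assms in auto)
  then have abs: "Infinite_Set_Sum.abs_summable_on p UNIV"
    by (simp add: abs_summable_on_def)
  have "infsetsum p UNIV = c"
    unfolding infsetsum_def by (subst integral_eq_nn_integral) (use assms in auto)
  moreover have "(p has_sum infsum p UNIV) UNIV"
    using abs abs_summable_equivalent[of p UNIV] abs_summable_summable[of p UNIV] has_sum_infsum[of p UNIV]
    by blast
  ultimately show ?thesis
    using infsetsum_infsum[OF abs] by simp
qed

lemma ennreal_mult_left_cancel:
  fixes x y :: ennreal
  assumes "ennreal r * x = ennreal r * y" "r > 0"
  shows "x = y"
proof -
  have "ennreal (1 / r) * ennreal r = 1"
    using assms(2) by (simp flip: ennreal_mult)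
  then have "z = ennreal (1 / r) * (ennreal r * z)" for z
    by (simp flip: mult.assoc)
  then show ?thesis
    using assms(1) by metis
qed

section \<open>Measures invariant under the tail relation\<close>

text \<open>
  A locally finite recurrent measure that is invariant and ergodic for the tail relation of the
  cocycle of \<open>\<phi>\<close>. The function \<open>f\<close> expresses \<open>\<phi>\<close>, which is constant on the states, in terms of the first
  coordinate.
\<close>

locale invariant_measure = mixing_shift A + sigma_finite_measure M
  for A :: "'s::countable \<Rightarrow> 's \<Rightarrow> bool" and M :: "(nat \<Rightarrow> 's) measure" +
  fixes \<phi> :: "(nat \<Rightarrow> 's) \<Rightarrow> 'g::ab_group_add" and f :: "'s \<Rightarrow> 'g"
  assumes sets_M: "sets M = sets (tms_borel A)"
    and phi: "\<And>x. x \<in> tms A \<Longrightarrow> \<phi> x = f (x 0)"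
    and locally_finite: "locally_finite_measure (tms_topology A) M"
    and recurrent: "recurrent_measure A M"
    and invariant: "rel_invariant (tail_rel A \<phi>) M"
    and ergodic: "rel_ergodic (tail_rel A \<phi>) M"
begin

lemma countable_words [simp]: "countable (W :: 's list set)"
  by (rule countable_subset[OF subset_UNIV countableI_type])

lemma space_M: "space M = tms A"
  using sets_eq_imp_space_eq[OF sets_M] by simp

lemma sets_M_cyl [simp]: "cyl A w \<in> sets M"
  and sets_M_prepend [simp]: "B \<in> sets M \<Longrightarrow> prepend A w B \<in> sets M"
  and sets_M_pull [simp]: "B \<in> sets M \<Longrightarrow> pull A w B \<in> sets M"
  by (simp_all add: sets_M)

lemma sets_M_tms [simp]: "tms A \<in> sets M"
  using sets.top[of M] by (simp add: space_M)

lemma tail_rel_iff: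
  "(x, y) \<in> tail_rel A \<phi> \<longleftrightarrow> x \<in> tms A \<and> y \<in> tms A \<and>
     (\<exists>n. suffix n x = suffix n y \<and> word_sum f (prefix n x) = word_sum f (prefix n y))"
  using phi by (auto simp: tail_rel_def shift_funpow birkhoff_sum_prefix[of A \<phi> f])

lemma tail_rel_conc:
  assumes "length v = length w" "word_sum f v = word_sum f w" "v \<frown> x \<in> tms A" "w \<frown> x \<in> tms A"
  shows "(v \<frown> x, w \<frown> x) \<in> tail_rel A \<phi>"
  unfolding tail_rel_iff using assms by (intro conjI exI[of _ "length v"]) auto

text \<open>
  Invariance, in the only form in which it is used: replacing an initial word by another one of
  the same length and with the same sum does not change the measure.
\<close>

lemma exchange:
  assumes v: "walk A s v t" and w: "walk A s' w t"
    and len: "length v = length w" and sum: "word_sum f v = word_sum f w"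
    and B: "B \<in> sets M" "B \<subseteq> cyl A [t]"
  shows "emeasure M (prepend A v B) = emeasure M (prepend A w B)"
proof -
  define \<kappa> where "\<kappa> v w x = w \<frown> suffix (length v) x" for v w :: "'s list" and x :: "nat \<Rightarrow> 's"
  have map: "\<kappa> v w x \<in> prepend A w B" "\<kappa> w v (\<kappa> v w x) = x"
    if w: "walk A s' w t" and x: "x \<in> prepend A v B" for v w s' x
  proof -
    from x obtain y where y: "x = v \<frown> y" "y \<in> B" "y \<in> tms A"
      by (elim prependE)
    with w B show "\<kappa> v w x \<in> prepend A w B"
      using conc_in_tms_if_walk(1)[OF w] by (auto simp: \<kappa>_def)
    from y show "\<kappa> w v (\<kappa> v w x) = x"
      by (simp add: \<kappa>_def)
  qed
  have bij: "bij_betw (\<kappa> v w) (prepend A v B) (prepend A w B)"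
    using map(1)[OF w] map(2)[OF w] map(1)[OF v] map(2)[OF v]
    by (intro bij_betw_byWitness[where f' = "\<kappa> w v"]) auto
  have meas: "\<kappa> v w \<in> measurable (restrict_space M (prepend A v B)) (restrict_space M (prepend A w B))"
    if w: "walk A s' w t" for v w s'
  proof (rule measurable_restrict_space2)
    show "\<kappa> v w \<in> space (restrict_space M (prepend A v B)) \<rightarrow> prepend A w B"
      using map(1)[OF w] by (auto simp: space_restrict_space)
    have "(\<lambda>x. w \<frown> suffix (length v) x) \<in> measurable (restrict_space (tms_borel A) (prepend A v B)) (tms_borel A)"
      by (rule measurable_conc_suffix)
        (use map(1)[OF w] prepend_subset_tms in \<open>auto simp: \<kappa>_def subset_iff\<close>)
    moreover have "measurable (restrict_space (tms_borel A) (prepend A v B)) (tms_borel A)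
        = measurable (restrict_space M (prepend A v B)) M"
      by (intro measurable_cong_sets) (auto simp: sets_M intro!: sets_restrict_space_cong)
    ultimately show "\<kappa> v w \<in> measurable (restrict_space M (prepend A v B)) M"
      by (simp add: \<kappa>_def[abs_def])
  qed
  have inv: "the_inv_into (prepend A v B) (\<kappa> v w) y = \<kappa> w v y" if "y \<in> prepend A w B" for y
    using that map(1)[OF v that] map(2)[OF v that] bij
    by (intro the_inv_into_f_eq) (auto simp: bij_betw_def)
  have "holonomy M (tail_rel A \<phi>) (\<kappa> v w) (prepend A v B) (prepend A w B)"
    unfolding holonomy_def
  proof (intro conjI ballI)
    show "the_inv_into (prepend A v B) (\<kappa> v w)
        \<in> measurable (restrict_space M (prepend A w B)) (restrict_space M (prepend A v B))"
      using meas[OF v, of w]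
      by (rule subst[OF measurable_cong, rotated]) (use inv in \<open>auto simp: space_restrict_space\<close>)
    fix x assume x: "x \<in> prepend A v B"
    then obtain y where y: "x = v \<frown> y" "y \<in> B" "v \<frown> y \<in> tms A"
      by (elim prependE)
    moreover have "w \<frown> y \<in> tms A"
      using y B conc_in_tms_if_walk(1)[OF w] by auto
    ultimately show "(x, \<kappa> v w x) \<in> tail_rel A \<phi>"
      using tail_rel_conc[OF len sum] by (simp add: \<kappa>_def)
  qed (use bij meas[OF w] B in auto)
  moreover have "prepend A v B \<in> sets M"
    using B(1) by simp
  ultimately have "emeasure M (\<kappa> v w ` prepend A v B) = emeasure M (prepend A v B)"
    using invariant unfolding rel_invariant_def by blast
  with bij show ?thesis
    by (simp add: bij_betw_def)
qed

text \<open>Almost every point visits its initial state infinitely often.\<close>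

lemma AE_recurrent: "AE x in M. \<forall>n. \<exists>m\<ge>n. x m = x 0"
proof -
  have "AE x in M. x 0 = s \<longrightarrow> (\<forall>n. \<exists>m\<ge>n. x m = s)" for s
  proof -
    have "AE x in M. (\<Sum>n. indicator (cyl A [s]) ((shift ^^ n) x) :: ennreal) \<in> {0, \<infinity>}"
      using recurrent unfolding recurrent_measure_def tms_partition_def by blast
    moreover have "AE x in M. x \<in> tms A"
      using AE_space[of M] by (simp add: space_M)
    ultimately show ?thesis
    proof eventually_elim
      fix x assume x: "(\<Sum>n. indicator (cyl A [s]) ((shift ^^ n) x) :: ennreal) \<in> {0, \<infinity>}" "x \<in> tms A"
      have ind: "indicator (cyl A [s]) ((shift ^^ n) x) = (if x n = s then 1 else 0 :: ennreal)" for n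
        using suffix_in_tms[OF x(2), of n] by (simp add: shift_funpow cyl_single_iff indicator_def)
      show "x 0 = s \<longrightarrow> (\<forall>n. \<exists>m\<ge>n. x m = s)"
      proof (intro impI allI, rule ccontr)
        fix n assume s: "x 0 = s" and n: "\<not> (\<exists>m\<ge>n. x m = s)"
        have eq: "(\<Sum>n. if x n = s then 1 else 0 :: ennreal) = (\<Sum>m<n. if x m = s then 1 else 0)"
          using n by (intro suminf_finite) (auto simp: not_less)
        moreover have "(\<Sum>m<n. if x m = s then 1 else 0 :: ennreal) \<noteq> \<infinity>"
          by (auto simp: infinity_ennreal_def)
        moreover have "(\<Sum>m<n. if x m = s then 1 else 0 :: ennreal) \<noteq> 0"
          using s n by (auto simp: sum_eq_0_iff intro!: bexI[of _ 0])
        ultimately show False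
          using x(1) by (simp add: ind)
      qed
    qed
  qed
  then have "AE x in M. \<forall>s. x 0 = s \<longrightarrow> (\<forall>n. \<exists>m\<ge>n. x m = s)"
    by (subst AE_all_countable) auto
  then show ?thesis
    by eventually_elim auto
qed

text \<open>Decomposition of a set of points starting with \<open>u\<close> at the first visit to \<open>u\<close> from the time \<open>|q|\<close> on.\<close>

lemma emeasure_prepend_first_visit:
  assumes D: "D \<in> sets M" and q: "prepend A q D \<subseteq> cyl A [u]"
  shows "emeasure M (prepend A q D) = (\<integral>\<^sup>+r. emeasure M (prepend A q (D \<inter> cyl A (r @ [u]))) \<partial>count_space {r. u \<notin> set r})"
proof -
  let ?X = "\<lambda>r. prepend A q (D \<inter> cyl A (r @ [u]))"
  have "emeasure M (prepend A q D) = emeasure M (\<Union>r\<in>{r. u \<notin> set r}. ?X r)"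
  proof (rule emeasure_eq_AE)
    show "AE x in M. x \<in> prepend A q D \<longleftrightarrow> x \<in> (\<Union>r\<in>{r. u \<notin> set r}. ?X r)"
      using AE_recurrent
    proof eventually_elim
      fix x :: "nat \<Rightarrow> 's" assume rec: "\<forall>n. \<exists>m\<ge>n. x m = x 0"
      have "x \<in> (\<Union>r\<in>{r. u \<notin> set r}. ?X r)" if x: "x \<in> prepend A q D"
      proof -
        from x obtain y where y: "x = q \<frown> y" "y \<in> D" "q \<frown> y \<in> tms A" "y \<in> tms A"
          by (elim prependE)
        have "x 0 = u"
          using x q by (auto simp: cyl_single_iff)
        with rec obtain m where "m \<ge> length q" "x m = u"
          by blast
        then have "y (m - length q) = u"
          by (simp add: y(1))
        then obtain r where "u \<notin> set r" "y \<in> cyl A (r @ [u])"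
          using first_visit_exists[OF y(4)] by blast
        with y show ?thesis
          by auto
      qed
      then show "x \<in> prepend A q D \<longleftrightarrow> x \<in> (\<Union>r\<in>{r. u \<notin> set r}. ?X r)"
        by (auto simp: prepend_def)
    qed
    show "(\<Union>r\<in>{r. u \<notin> set r}. ?X r) \<in> sets M"
      using D by (intro sets.countable_UN') (auto intro!: sets_M_prepend sets.Int)
  qed (use D in simp)
  also have "\<dots> = (\<integral>\<^sup>+r. emeasure M (?X r) \<partial>count_space {r. u \<notin> set r})"
  proof (rule emeasure_UN_countable)
    show "disjoint_family_on ?X {r. u \<notin> set r}"
      by (auto simp: disjoint_family_on_def prepend_def dest: first_visit_unique)
  qed (use D in \<open>auto intro!: sets_M_prepend sets.Int\<close>)
  finally show ?thesis .
qed

lemma emeasure_cyl_first_visit: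
  assumes "q \<noteq> []" "hd q = u"
  shows "emeasure M (cyl A q) = (\<integral>\<^sup>+r. emeasure M (cyl A (q @ r @ [u])) \<partial>count_space {r. u \<notin> set r})"
proof -
  have "cyl A q \<subseteq> cyl A [u]"
    using assms by (auto simp: cyl_def hd_conv_nth)
  moreover have "prepend A q (tms A) = cyl A q"
    using prepend_cyl[of A q "[]"] by simp
  moreover have "prepend A q (tms A \<inter> cyl A (r @ [u])) = cyl A (q @ r @ [u])" for r
    using cyl_subset_tms[of A "r @ [u]"] by (simp add: Int_absorb1 prepend_cyl)
  ultimately show ?thesis
    using emeasure_prepend_first_visit[of "tms A" q u] by simp
qed

lemma finite_cylinders_cover: "(\<Union>w\<in>{w. emeasure M (cyl A w) < \<infinity>}. cyl A w) = tms A"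
proof (intro equalityI subsetI)
  fix x assume x: "x \<in> tms A"
  then obtain V where V: "openin (tms_topology A) V" "x \<in> V" "emeasure M V < \<infinity>"
    using locally_finite unfolding locally_finite_measure_def topspace_tms by blast
  obtain n where "cyl A (prefix (Suc n) x) \<subseteq> V"
    using openin_tms_cyl[OF V(1,2)] by blast
  moreover have "V \<in> sets M"
    using V(1) sets_openin by (simp add: sets_M)
  ultimately have "emeasure M (cyl A (prefix (Suc n) x)) < \<infinity>"
    using V(3) by (meson emeasure_mono le_less_trans)
  then show "x \<in> (\<Union>w\<in>{w. emeasure M (cyl A w) < \<infinity>}. cyl A w)"
    using cyl_prefix[OF x] by blast
qed (auto simp: cyl_def)

lemma pos_cylinder_subset:
  assumes "D \<in> sets M" "emeasure M D \<noteq> 0"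
  shows "\<exists>w. emeasure M (cyl A w) < \<infinity> \<and> emeasure M (D \<inter> cyl A w) \<noteq> 0"
proof (rule ccontr)
  assume no: "\<not> ?thesis"
  have "D \<inter> cyl A w \<in> null_sets M" if "emeasure M (cyl A w) < \<infinity>" for w
    using sets.Int[OF assms(1) sets_M_cyl[of w]] that no by (auto simp: null_sets_def)
  then have "(\<Union>w\<in>{w. emeasure M (cyl A w) < \<infinity>}. D \<inter> cyl A w) \<in> null_sets M"
    by (intro null_sets_UN') auto
  also have "(\<Union>w\<in>{w. emeasure M (cyl A w) < \<infinity>}. D \<inter> cyl A w) = D"
    using finite_cylinders_cover sets.sets_into_space[OF assms(1)] by (auto simp: space_M)
  finally show False
    using assms(2) by auto
qed

text \<open>The measure \<open>B \<mapsto> M (w (B \<inter> C))\<close>, obtained as the image of \<open>M\<close> restricted to \<open>w C\<close> under a power of the shift.\<close>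

definition pre_measure :: "'s list \<Rightarrow> (nat \<Rightarrow> 's) set \<Rightarrow> (nat \<Rightarrow> 's) measure" where
  "pre_measure w C = distr (restrict_space M (prepend A w C)) M (suffix (length w))"

lemma sets_pre_measure [simp]: "sets (pre_measure w C) = sets M"
  by (simp add: pre_measure_def)

lemma emeasure_pre_measure:
  assumes "C \<in> sets M" "B \<in> sets M"
  shows "emeasure (pre_measure w C) B = emeasure M (prepend A w (B \<inter> C))"
proof -
  have "suffix (length w) \<in> measurable M M"
    using measurable_suffix by (simp add: measurable_cong_sets[OF sets_M sets_M])
  then have "suffix (length w) \<in> measurable (restrict_space M (prepend A w C)) M"
    by (rule measurable_restrict_space1)
  then have "emeasure (pre_measure w C) B
      = emeasure (restrict_space M (prepend A w C)) (suffix (length w) -` B \<inter> space (restrict_space M (prepend A w C)))"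
    unfolding pre_measure_def using assms by (intro emeasure_distr) auto
  also have "\<dots> = emeasure M (suffix (length w) -` B \<inter> space (restrict_space M (prepend A w C)))"
    using assms by (intro emeasure_restrict_space) (auto simp: space_restrict_space)
  also have "suffix (length w) -` B \<inter> space (restrict_space M (prepend A w C)) = prepend A w (B \<inter> C)"
    using prepend_subset_tms by (auto simp: space_restrict_space space_M prepend_def cyl_def)
  finally show ?thesis .
qed

text \<open>
  On the points starting with \<open>u\<close> the measure is invariant under the first return map, whose inverse
  branches prepend the words \<open>u r\<close> where \<open>u\<close> does not occur in \<open>r\<close>. For cylinders this holds because
  an excursion inserted at the beginning may, by \<open>exchange\<close>, be moved to the first return after the
  word of the cylinder. The state \<open>u\<close> may a priori have infinite measure, but by local finiteness the
  cylinders of finite measure cover the space, so that the values on cylinders determine the measure.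
\<close>

lemma first_return_invariant:
  assumes "B \<in> sets M"
  shows "(\<integral>\<^sup>+r. emeasure M (prepend A (u # r) (B \<inter> cyl A [u])) \<partial>count_space {r. u \<notin> set r})
    = emeasure M (B \<inter> cyl A [u])"
proof -
  let ?R = "{r. u \<notin> set r}"
  have swap: "emeasure M (cyl A (v @ w @ [u])) = emeasure M (cyl A (w @ v @ [u]))"
    if "hd v = u" "hd w = u" "v \<noteq> []" "w \<noteq> []" for v w
  proof (cases "walk A u v u \<and> walk A u w u")
    case True
    then show ?thesis
      using exchange[of u "v @ w" u u "w @ v" "cyl A [u]"]
      by (auto simp: prepend_cyl add.commute intro: walk_append)
  next
    case False
    have "cyl A (v @ w @ [u]) = {}" if "\<not> (walk A u v u \<and> walk A u w u)" "hd v = u" "hd w = u" "v \<noteq> []" "w \<noteq> []" for v w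
      using walk_of_cyl_nonempty[of "v @ w" u] that by (auto simp: walk_append_iff)
    then have "cyl A (v @ w @ [u]) = {}" "cyl A (w @ v @ [u]) = {}"
      using False that by blast+
    then show ?thesis by simp
  qed
  have cyl: "(\<integral>\<^sup>+r. emeasure M (prepend A (u # r) (cyl A p)) \<partial>count_space ?R) = emeasure M (cyl A p)"
    if p: "p \<noteq> []" "hd p = u" for p
  proof -
    note split = emeasure_cyl_first_visit[of _ u]
    have "(\<integral>\<^sup>+r. emeasure M (prepend A (u # r) (cyl A p)) \<partial>count_space ?R)
        = (\<integral>\<^sup>+r. \<integral>\<^sup>+r'. emeasure M (cyl A ((u # r) @ (p @ r') @ [u])) \<partial>count_space ?R \<partial>count_space ?R)"
      unfolding prepend_cyl by (subst split) auto
    also have "\<dots> = (\<integral>\<^sup>+r. \<integral>\<^sup>+r'. emeasure M (cyl A ((p @ r') @ (u # r) @ [u])) \<partial>count_space ?R \<partial>count_space ?R)"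
      using p by (intro nn_integral_cong swap) auto
    also have "\<dots> = (\<integral>\<^sup>+r'. \<integral>\<^sup>+r. emeasure M (cyl A ((p @ r' @ [u]) @ r @ [u])) \<partial>count_space ?R \<partial>count_space ?R)"
      by (subst nn_integral_count_space_nn_integral) auto
    also have "\<dots> = (\<integral>\<^sup>+r'. emeasure M (cyl A (p @ r' @ [u])) \<partial>count_space ?R)"
      using p by (intro nn_integral_cong split[symmetric]) auto
    also have "\<dots> = emeasure M (cyl A p)"
      using p by (rule split[symmetric])
    finally show ?thesis .
  qed
  obtain N where N: "sets N = sets M" "\<And>B. B \<in> sets M \<Longrightarrow>
      emeasure N B = (\<integral>\<^sup>+r. emeasure (pre_measure (u # r) (cyl A [u])) B \<partial>count_space ?R)"
    by (rule sum_measure_exists[of "\<lambda>r. pre_measure (u # r) (cyl A [u])" M ?R]) auto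
  have N_eq: "emeasure N B = (\<integral>\<^sup>+r. emeasure M (prepend A (u # r) (B \<inter> cyl A [u])) \<partial>count_space ?R)"
    if "B \<in> sets M" for B
    using that by (simp add: N(2) emeasure_pre_measure)
  let ?N' = "pre_measure [] (cyl A [u])"
  have N'_eq: "emeasure ?N' B = emeasure M (B \<inter> cyl A [u])" if "B \<in> sets M" for B
    using that cyl_subset_tms by (subst emeasure_pre_measure) (auto intro!: arg_cong[where f = "emeasure M"] prepend_Nil)
  have "?N' = N"
  proof (rule measure_eqI_generator_eq_countable)
    show "Int_stable (insert {} (range (cyl A)))"
      by (rule Int_stable_cyl)
    show "insert {} (range (cyl A)) \<subseteq> Pow (tms A)"
      using cyl_subset_tms by auto
    have "sigma_sets (tms A) (insert {} (range (cyl A))) = sigma_sets (tms A) (range (cyl A))"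
      by (rule sigma_sets_eqI) (auto intro: sigma_sets.intros)
    then show "sets N = sigma_sets (tms A) (insert {} (range (cyl A)))"
      "sets ?N' = sigma_sets (tms A) (insert {} (range (cyl A)))"
      by (simp_all add: N sets_M sets_tms_borel)
    show "cyl A ` {w. emeasure M (cyl A w) < \<infinity>} \<subseteq> insert {} (range (cyl A))"
      by auto
    show "\<Union> (cyl A ` {w. emeasure M (cyl A w) < \<infinity>}) = tms A"
      by (rule finite_cylinders_cover)
    show "countable (cyl A ` {w. emeasure M (cyl A w) < \<infinity>})"
      by simp
    fix X assume X: "X \<in> insert {} (range (cyl A))"
    show "emeasure ?N' X = emeasure N X"
    proof (cases "X = {}")
      case False
      with X obtain p where p: "X = cyl A p" by auto
      have "X \<inter> cyl A [u] = cyl A (if p = [] then [u] else p) \<or> X \<inter> cyl A [u] = {}"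
        by (cases "p = []") (auto simp: p cyl_def hd_conv_nth)
      then consider q where "X \<inter> cyl A [u] = cyl A q" "q \<noteq> []" "cyl A q \<noteq> {}" | "X \<inter> cyl A [u] = {}"
        by (metis list.distinct(1))
      then show ?thesis
      proof cases
        case 1
        then obtain x where "x \<in> cyl A q" "x \<in> cyl A [u]"
          by blast
        then have "hd q = u"
          using 1(2) by (auto simp: cyl_def hd_conv_nth)
        with 1 cyl[of q] show ?thesis
          by (simp add: N_eq N'_eq p)
      next
        case 2
        then show ?thesis
          by (simp add: N_eq N'_eq p prepend_def)
      qed
    qed simp
  next
    fix X assume "X \<in> cyl A ` {w. emeasure M (cyl A w) < \<infinity>}"
    then obtain w where w: "X = cyl A w" "emeasure M (cyl A w) < \<infinity>" by auto
    have "emeasure ?N' X \<le> emeasure M (cyl A w)"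
      unfolding w(1) by (subst N'_eq) (auto intro!: emeasure_mono)
    with w(2) show "emeasure ?N' X \<noteq> \<infinity>" by auto
  qed
  then show ?thesis
    using N_eq[OF assms] N'_eq[OF assms] by simp
qed


section \<open>Ergodicity\<close>

lemma tail_rel_saturation:
  assumes "E \<in> sets M"
  shows "tail_rel A \<phi> `` E = (\<Union>(v, w, t)\<in>{(v, w, t). length v = length w \<and> word_sum f v = word_sum f w}.
    prepend A w (pull A v E \<inter> cyl A [t]))"
proof (intro equalityI subsetI)
  fix y assume "y \<in> tail_rel A \<phi> `` E"
  then obtain x n where x: "x \<in> E" "x \<in> tms A" "y \<in> tms A" "suffix n x = suffix n y"
      "word_sum f (prefix n x) = word_sum f (prefix n y)"
    by (auto simp: tail_rel_iff)
  let ?z = "suffix n y"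
  have "prefix n x \<frown> ?z = x" "prefix n y \<frown> ?z = y"
    using prefix_suffix[of x n] prefix_suffix[of y n] x(4) by simp_all
  then have "?z \<in> pull A (prefix n x) E \<inter> cyl A [y n]" "y \<in> prepend A (prefix n y) (pull A (prefix n x) E \<inter> cyl A [y n])"
    using x conc_in_prepend[of "prefix n y" ?z A] by (auto simp: pull_def suffix_in_tms cyl_single_iff)
  with x(5) show "y \<in> (\<Union>(v, w, t)\<in>{(v, w, t). length v = length w \<and> word_sum f v = word_sum f w}.
    prepend A w (pull A v E \<inter> cyl A [t]))"
    by (intro UN_I[of "(prefix n x, prefix n y, y n)"]) auto
next
  fix y assume "y \<in> (\<Union>(v, w, t)\<in>{(v, w, t). length v = length w \<and> word_sum f v = word_sum f w}.
    prepend A w (pull A v E \<inter> cyl A [t]))"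
  then obtain v w t where "length v = length w" "word_sum f v = word_sum f w"
      "y \<in> prepend A w (pull A v E \<inter> cyl A [t])"
    by auto
  moreover from this obtain z where "y = w \<frown> z" "w \<frown> z \<in> tms A" "v \<frown> z \<in> E"
    by (auto elim!: prependE simp: pull_def)
  moreover have "v \<frown> z \<in> tms A"
    using calculation(6) sets.sets_into_space[OF assms] by (auto simp: space_M)
  ultimately show "y \<in> tail_rel A \<phi> `` E"
    using tail_rel_conc by blast
qed

lemma subset_saturation: "E \<subseteq> tms A \<Longrightarrow> E \<subseteq> tail_rel A \<phi> `` E"
  by (auto simp: tail_rel_iff subset_iff intro!: ImageI exI[of _ 0])

lemma sets_saturation [simp]:
  assumes "E \<in> sets M"
  shows "tail_rel A \<phi> `` E \<in> sets M"
  unfolding tail_rel_saturation[OF assms]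
  using assms by (intro sets.countable_UN') (auto intro!: sets_M_prepend sets.Int countable_subset[OF subset_UNIV countableI_type])

text \<open>The ergodicity hypothesis, which concerns exact unions of classes, applied to a saturation.\<close>

lemma saturation_trivial:
  assumes "E \<in> sets M"
  shows "emeasure M (tail_rel A \<phi> `` E) = 0 \<or> emeasure M (tms A - tail_rel A \<phi> `` E) = 0"
proof -
  have "tail_rel A \<phi> `` E = \<Union> ((\<lambda>x. tail_rel A \<phi> `` {x}) ` E)"
    by auto
  moreover have "(\<lambda>x. tail_rel A \<phi> `` {x}) ` E \<subseteq> space M // tail_rel A \<phi>"
    using sets.sets_into_space[OF assms] by (auto simp: quotient_def)
  ultimately show ?thesis
    using ergodic sets_saturation[OF assms] unfolding rel_ergodic_def space_M by metis
qed

text \<open>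
  A measure dominated by \<open>M\<close> that is also unchanged by the exchange of words has, on a state, an
  invariant density, which is constant by ergodicity.
\<close>

lemma ergodic_proportional:
  assumes N: "sets N = sets M"
    and le: "\<And>B. B \<in> sets M \<Longrightarrow> emeasure N B \<le> emeasure M B"
    and swap: "\<And>v w t B. walk A u v t \<Longrightarrow> walk A u w t \<Longrightarrow> length v = length w \<Longrightarrow>
      word_sum f v = word_sum f w \<Longrightarrow> B \<in> sets M \<Longrightarrow> B \<subseteq> cyl A [t] \<Longrightarrow>
      emeasure N (prepend A v B) = emeasure N (prepend A w B)"
  obtains c where "\<And>B. B \<in> sets M \<Longrightarrow> B \<subseteq> cyl A [u] \<Longrightarrow> emeasure N B = c * emeasure M B"
proof -
  have "absolutely_continuous M N"
    using le N unfolding absolutely_continuous_def null_sets_def by fastforce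
  then obtain g where g: "g \<in> borel_measurable M" "density M g = N"
    using Radon_Nikodym N by blast
  have N_eq: "emeasure N B = (\<integral>\<^sup>+x. g x * indicator B x \<partial>M)" if "B \<in> sets M" for B
    using g that by (auto simp: emeasure_density)
  have level: "(AE x in M. x \<in> cyl A [u] \<longrightarrow> c < g x) \<or> (AE x in M. x \<in> cyl A [u] \<longrightarrow> g x \<le> c)" for c
  proof (cases "c = \<infinity>")
    case False
    define E where "E = {x \<in> space M. c < g x} \<inter> cyl A [u]"
    have E: "E \<in> sets M"
      unfolding E_def using g(1) by (intro sets.Int) auto
    have Eu: "E \<subseteq> cyl A [u]" "E \<subseteq> tms A"
      by (auto simp: E_def cyl_def)
    \<comment> \<open>Points of the saturation of \<open>E\<close> that start with \<open>u\<close> but lie outside \<open>E\<close> are negligible: an exchange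
      of words maps them to points of \<open>E\<close> without changing \<open>M\<close> and \<open>N\<close>, although the density is larger there.\<close>
    have null: "emeasure M (prepend A w (pull A v E \<inter> cyl A [t]) \<inter> cyl A [u] - E) = 0"
      if vw: "length v = length w" "word_sum f v = word_sum f w" for v w t
    proof (rule ccontr)
      let ?K = "prepend A w (pull A v E \<inter> cyl A [t]) \<inter> cyl A [u] - E"
      assume "emeasure M ?K \<noteq> 0"
      moreover have K: "?K \<in> sets M"
        using E by (intro sets.Diff sets.Int sets_M_prepend sets_M_pull) auto
      ultimately obtain p where p: "emeasure M (cyl A p) < \<infinity>" "emeasure M (?K \<inter> cyl A p) \<noteq> 0"
        using pos_cylinder_subset by blast
      define Q where "Q = ?K \<inter> cyl A p"
      have Q: "Q \<in> sets M"
        unfolding Q_def using K by (intro sets.Int) auto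
      have Q_fin: "emeasure M Q < \<infinity>"
        using p(1) by (rule le_less_trans[rotated]) (auto intro!: emeasure_mono simp: Q_def)
      define P where "P = pull A w Q"
      have P: "P \<in> sets M"
        using Q by (simp add: P_def)
      have P_sub: "P \<subseteq> pull A v E \<inter> cyl A [t]"
        by (auto simp: P_def Q_def pull_def)
      have Q_ext: "prepend A w P = Q"
        unfolding P_def prepend_pull using prepend_subset_cyl[of A w] by (auto simp: Q_def)
      have prepend_vP: "prepend A v P \<subseteq> E"
        using P_sub by (auto elim!: prependE simp: pull_def)
      have "Q \<noteq> {}"
        using p(2) by (auto simp: Q_def)
      then obtain z where z: "z \<in> P"
        using Q_ext by (auto simp: prepend_def)
      then have "v \<frown> z \<in> cyl A [u]" "w \<frown> z \<in> cyl A [u]" "z 0 = t"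
        using P_sub Eu by (auto simp: P_def Q_def pull_def cyl_single_iff)
      then have walks: "walk A u v t" "walk A u w t"
        by (auto simp: cyl_single_iff conc_in_tms_walk conc_nth_0)
      have M_eq: "emeasure M (prepend A v P) = emeasure M Q"
        using exchange[OF walks vw P] P_sub by (simp add: Q_ext)
      have N_eq': "emeasure N (prepend A v P) = emeasure N Q"
        using swap[OF walks vw P] P_sub by (simp add: Q_ext)
      have vP: "prepend A v P \<in> sets M"
        using P by simp
      have "emeasure N Q \<le> (\<integral>\<^sup>+x. c * indicator Q x \<partial>M)"
        unfolding N_eq[OF Q]
        by (intro nn_integral_mono) (use Eu in \<open>auto simp: Q_def E_def indicator_def space_M cyl_def\<close>)
      also have "\<dots> = c * emeasure M (prepend A v P)"
        using Q by (simp add: nn_integral_cmult_indicator M_eq)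
      also have "\<dots> = (\<integral>\<^sup>+x. c * indicator (prepend A v P) x \<partial>M)"
        using vP by (simp add: nn_integral_cmult_indicator)
      also have "\<dots> < (\<integral>\<^sup>+x. g x * indicator (prepend A v P) x \<partial>M)"
      proof (rule nn_integral_less)
        show "(\<lambda>x. c * indicator (prepend A v P) x) \<in> borel_measurable M"
          using vP by auto
        show "(\<lambda>x. g x * indicator (prepend A v P) x) \<in> borel_measurable M"
          using vP g(1) by auto
        show "(\<integral>\<^sup>+x. c * indicator (prepend A v P) x \<partial>M) \<noteq> \<infinity>"
          using vP False Q_fin
          by (auto simp: nn_integral_cmult_indicator M_eq ennreal_mult_eq_top_iff)
        show "AE x in M. c * indicator (prepend A v P) x \<le> g x * indicator (prepend A v P) x"
          using prepend_vP by (auto simp: E_def indicator_def less_imp_le subset_iff)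
        show "\<not> (AE x in M. g x * indicator (prepend A v P) x \<le> c * indicator (prepend A v P) x)"
        proof
          assume "AE x in M. g x * indicator (prepend A v P) x \<le> c * indicator (prepend A v P) x"
          then have "AE x in M. x \<notin> prepend A v P"
            by eventually_elim (use prepend_vP in \<open>auto simp: E_def indicator_def subset_iff not_le split: if_splits\<close>)
          then have "emeasure M (prepend A v P) = 0"
            using AE_iff_null_sets[OF vP] by auto
          with p(2) show False
            by (simp add: M_eq Q_def)
        qed
      qed
      also have "\<dots> = emeasure N Q"
        using N_eq[OF vP] N_eq' by simp
      finally show False by simp
    qed
    let ?J = "{(v, w, t :: 's). length v = length w \<and> word_sum f v = word_sum f w}"
    have "(\<Union>(v, w, t)\<in>?J. prepend A w (pull A v E \<inter> cyl A [t]) \<inter> cyl A [u] - E) \<in> null_sets M"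
    proof (rule null_sets_UN')
      show "countable ?J"
        by (rule countable_subset[OF subset_UNIV countableI_type])
      fix j assume "j \<in> ?J"
      then show "(case j of (v, w, t) \<Rightarrow> prepend A w (pull A v E \<inter> cyl A [t]) \<inter> cyl A [u] - E) \<in> null_sets M"
        using null E by (auto intro!: null_setsI sets.Diff sets.Int sets_M_prepend sets_M_pull)
    qed
    also have "(\<Union>(v, w, t)\<in>?J. prepend A w (pull A v E \<inter> cyl A [t]) \<inter> cyl A [u] - E)
        = tail_rel A \<phi> `` E \<inter> cyl A [u] - E"
      unfolding tail_rel_saturation[OF E] by auto
    finally have sat: "tail_rel A \<phi> `` E \<inter> cyl A [u] - E \<in> null_sets M" .
    from saturation_trivial[OF E] show ?thesis
    proof
      assume "emeasure M (tail_rel A \<phi> `` E) = 0"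
      then have "tail_rel A \<phi> `` E \<in> null_sets M"
        using sets_saturation[OF E] by (rule null_setsI)
      then have "E \<in> null_sets M"
        using E subset_saturation[OF Eu(2)] by (rule null_sets_subset)
      then have "AE x in M. x \<in> cyl A [u] \<longrightarrow> g x \<le> c"
        by (rule AE_I') (auto simp: E_def not_le)
      then show ?thesis ..
    next
      assume "emeasure M (tms A - tail_rel A \<phi> `` E) = 0"
      then have "tms A - tail_rel A \<phi> `` E \<in> null_sets M"
        using sets_saturation[OF E] by (auto intro!: null_setsI sets.Diff)
      then have "(tms A - tail_rel A \<phi> `` E) \<union> (tail_rel A \<phi> `` E \<inter> cyl A [u] - E) \<in> null_sets M"
        using sat by (rule null_sets.Un)
      then have "AE x in M. x \<in> cyl A [u] \<longrightarrow> c < g x"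
        by (rule AE_I') (auto simp: E_def space_M)
      then show ?thesis ..
    qed
  qed simp
  then obtain c where c: "AE x in M. x \<in> cyl A [u] \<longrightarrow> g x = c"
    using AE_constant_if_level_sets_trivial by blast
  have "emeasure N B = c * emeasure M B" if B: "B \<in> sets M" "B \<subseteq> cyl A [u]" for B
  proof -
    from c have "AE x in M. g x * indicator B x = c * indicator B x"
      by eventually_elim (use B(2) in \<open>auto simp: indicator_def\<close>)
    then have "(\<integral>\<^sup>+x. g x * indicator B x \<partial>M) = (\<integral>\<^sup>+x. c * indicator B x \<partial>M)"
      by (rule nn_integral_cong_AE)
    then show ?thesis
      using B by (simp add: N_eq nn_integral_cmult_indicator)
  qed
  then show ?thesis
    using that by blast
qed

section \<open>Multipliers of loops\<close>

text \<open>
  By \<open>first_return_invariant\<close> the measure \<open>M\<close> is on the state \<open>u\<close> the sum of its pullbacks under the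
  inverse branches of the first return map. So each of these pullbacks is dominated by \<open>M\<close>, and
  therefore proportional to it.
\<close>

lemma first_return_multiplier:
  assumes r: "u \<notin> set r"
  shows "\<exists>c. \<forall>B\<in>sets M. B \<subseteq> cyl A [u] \<longrightarrow> emeasure M (prepend A (u # r) B) = c * emeasure M B"
proof -
  let ?N = "pre_measure (u # r) (cyl A [u])"
  have N: "emeasure ?N B = emeasure M (prepend A (u # r) B)" if "B \<in> sets M" "B \<subseteq> cyl A [u]" for B
    using that by (simp add: emeasure_pre_measure Int_absorb2)
  obtain c where "\<And>B. B \<in> sets M \<Longrightarrow> B \<subseteq> cyl A [u] \<Longrightarrow> emeasure ?N B = c * emeasure M B"
  proof (rule ergodic_proportional[of ?N u])
    fix B assume B: "B \<in> sets M"
    have "emeasure ?N B = emeasure M (prepend A (u # r) (B \<inter> cyl A [u]))"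
      using B by (simp add: emeasure_pre_measure)
    also have "\<dots> \<le> (\<integral>\<^sup>+r. emeasure M (prepend A (u # r) (B \<inter> cyl A [u])) \<partial>count_space {r. u \<notin> set r})"
      by (rule nn_integral_ge_point) (use r in simp)
    also have "\<dots> \<le> emeasure M B"
      unfolding first_return_invariant[OF B] using B by (intro emeasure_mono) auto
    finally show "emeasure ?N B \<le> emeasure M B" .
  next
    fix v w t B
    assume vw: "walk A u v t" "walk A u w t" "length v = length w" "word_sum f v = word_sum f w"
      and B: "B \<in> sets M" "B \<subseteq> cyl A [t]"
    have N_ext: "emeasure ?N (prepend A v B) = emeasure M (prepend A ((u # r) @ v) B)"
      if "walk A u v t" for v
      using that B N[of "prepend A v B"] prepend_subset_cyl_walk[OF that B(2)] by (simp add: prepend_prepend)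
    show "emeasure ?N (prepend A v B) = emeasure ?N (prepend A w B)"
    proof (cases "walk A u (u # r) u")
      case True
      have "emeasure M (prepend A ((u # r) @ v) B) = emeasure M (prepend A ((u # r) @ w) B)"
        using vw B by (intro exchange[OF walk_append[OF True] walk_append[OF True]]) auto
      then show ?thesis
        using vw by (simp add: N_ext)
    next
      case False
      have "emeasure ?N (prepend A v B) = 0" if "walk A u v t" for v
        unfolding N_ext[OF that] prepend_prepend[symmetric]
        using prepend_empty_if_not_walk[OF prepend_subset_cyl_walk[OF that B(2)], of "u # r"] False by simp
      then show ?thesis
        using vw by simp
    qed
  qed auto
  then show ?thesis
    using N by metis
qed

text \<open>A loop is a concatenation of first return words.\<close>

lemma loop_multiplier_exists:
  assumes "walk A u w u"
  shows "\<exists>c. \<forall>B\<in>sets M. B \<subseteq> cyl A [u] \<longrightarrow> emeasure M (prepend A w B) = c * emeasure M B"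
  using assms
proof (induction w rule: length_induct)
  case (1 w)
  show ?case
  proof (cases w)
    case Nil
    then show ?thesis
      using cyl_subset_tms by (intro exI[of _ 1]) (auto intro!: arg_cong[where f = "emeasure M"] prepend_Nil)
  next
    case (Cons a w')
    then have [simp]: "a = u"
      using 1(2) by (simp add: walk_Cons)
    have "u \<in> set (w' @ [u])" by simp
    then obtain r zs where r: "w' @ [u] = r @ u # zs" "u \<notin> set r"
      by (metis split_list_first)
    define v where "v = butlast (u # zs)"
    have "butlast (w' @ [u]) = r @ v"
      unfolding r(1) v_def by (simp add: butlast_append)
    then have w: "w = (u # r) @ v"
      by (simp add: Cons)
    have "hd (v @ [u]) = u"
      by (auto simp: v_def)
    then have v: "walk A u v u"
      using 1(2) unfolding w by (simp only: walk_append_iff)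
    then obtain c where c: "\<And>B. B \<in> sets M \<Longrightarrow> B \<subseteq> cyl A [u] \<Longrightarrow> emeasure M (prepend A v B) = c * emeasure M B"
      using 1(1) unfolding w by force
    obtain d where d: "\<And>B. B \<in> sets M \<Longrightarrow> B \<subseteq> cyl A [u] \<Longrightarrow> emeasure M (prepend A (u # r) B) = d * emeasure M B"
      using first_return_multiplier[OF r(2)] by blast
    show ?thesis
    proof (intro exI[of _ "d * c"] ballI impI)
      fix B assume B: "B \<in> sets M" "B \<subseteq> cyl A [u]"
      have "emeasure M (prepend A w B) = d * emeasure M (prepend A v B)"
        unfolding w prepend_prepend[symmetric] using B prepend_subset_cyl_walk[OF v B(2)] by (intro d) auto
      then show "emeasure M (prepend A w B) = d * c * emeasure M B"
        using B by (simp add: c mult.assoc)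
    qed
  qed
qed

text \<open>
  Some loop leads through a cylinder of finite positive measure. Its multiplier is positive, and the
  product of it with the measure of the state \<open>u\<close> is finite.
\<close>

lemma emeasure_state_finite: "emeasure M (cyl A [u]) < \<infinity>"
proof (cases "emeasure M (cyl A [u]) = 0")
  case False
  then obtain w where w: "emeasure M (cyl A w) < \<infinity>" "emeasure M (cyl A [u] \<inter> cyl A w) \<noteq> 0"
    using pos_cylinder_subset[of "cyl A [u]"] by auto
  show ?thesis
  proof (cases "w = []")
    case True
    then show ?thesis
      using w(1) emeasure_mono[OF cyl_subset_tms[of A "[u]"] sets_M_tms] by (auto intro: le_less_trans)
  next
    case False
    obtain x where "x \<in> cyl A [u]" "x \<in> cyl A w"
      using w(2) by (metis emeasure_empty disjoint_iff)
    with False have hd: "hd w = u"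
      by (auto simp: cyl_def hd_conv_nth)
    have "emeasure M (cyl A w) \<noteq> 0"
      using w(2) emeasure_mono[OF Int_lower2[of "cyl A [u]" "cyl A w"], of M] by auto
    then obtain r where r: "emeasure M (cyl A (w @ r @ [u])) \<noteq> 0"
      unfolding emeasure_cyl_first_visit[OF False hd] by (auto simp: nn_integral_0_iff_AE AE_count_space)
    then have "cyl A ((w @ r) @ [u]) \<noteq> {}"
      by auto
    then have "walk A u (w @ r) u"
      using walk_of_cyl_nonempty[of "w @ r" u] False hd by auto
    from loop_multiplier_exists[OF this] obtain c where
      "\<forall>B\<in>sets M. B \<subseteq> cyl A [u] \<longrightarrow> emeasure M (prepend A (w @ r) B) = c * emeasure M B" ..
    then have c: "emeasure M (cyl A (w @ r @ [u])) = c * emeasure M (cyl A [u])"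
      by (auto simp: prepend_cyl dest: bspec[of _ _ "cyl A [u]"])
    moreover have "emeasure M (cyl A (w @ r @ [u])) < \<infinity>"
      using w(1) emeasure_mono[OF cyl_append_subset[of A w "r @ [u]"], of M] by (auto intro: le_less_trans)
    ultimately show ?thesis
      using r by (auto simp: ennreal_mult_less_top)
  qed
qed simp

text \<open>
  The factor by which prepending the loop \<open>w\<close> at \<open>u\<close> changes the measure of a set of points starting with
  \<open>u\<close>. It is meaningful if the state \<open>u\<close> has positive measure; the measure is then finite.
\<close>

definition loop_multiplier :: "'s \<Rightarrow> 's list \<Rightarrow> real" where
  "loop_multiplier u w = measure M (cyl A (w @ [u])) / measure M (cyl A [u])"

lemma emeasure_loop:
  assumes u: "emeasure M (cyl A [u]) \<noteq> 0" and w: "walk A u w u"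
    and B: "B \<in> sets M" "B \<subseteq> cyl A [u]"
  shows "emeasure M (prepend A w B) = ennreal (loop_multiplier u w) * emeasure M B"
proof -
  obtain c where c: "\<And>B. B \<in> sets M \<Longrightarrow> B \<subseteq> cyl A [u] \<Longrightarrow> emeasure M (prepend A w B) = c * emeasure M B"
    using loop_multiplier_exists[OF w] by blast
  have eq: "emeasure M (cyl A (w @ [u])) = c * emeasure M (cyl A [u])"
    using c[of "cyl A [u]"] by (simp add: prepend_cyl)
  have sub: "cyl A (w @ [u]) \<subseteq> cyl A [u]"
    using prepend_subset_cyl_walk[OF w order_refl] by (simp add: prepend_cyl)
  have fin: "emeasure M (cyl A (w @ [u])) < \<infinity>"
    using emeasure_mono[OF sub, of M] emeasure_state_finite[of u] by (auto intro: le_less_trans)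
  then have "c < \<infinity>"
    using eq u by (auto simp: ennreal_mult_less_top)
  then obtain r where r: "c = ennreal r" "r \<ge> 0"
    by (cases c) auto
  have meas: "emeasure M (cyl A (w @ [u])) = ennreal (measure M (cyl A (w @ [u])))"
      "emeasure M (cyl A [u]) = ennreal (measure M (cyl A [u]))"
    using fin emeasure_state_finite[of u] by (simp_all add: emeasure_eq_ennreal_measure less_top)
  have "ennreal (measure M (cyl A (w @ [u]))) = ennreal (r * measure M (cyl A [u]))"
    using eq r(2) unfolding meas r(1) by (simp add: ennreal_mult)
  then have "measure M (cyl A (w @ [u])) = r * measure M (cyl A [u])"
    using r by (subst (asm) ennreal_inj) auto
  moreover have "measure M (cyl A [u]) \<noteq> 0"
    using u meas(2) by auto
  ultimately have "loop_multiplier u w = r"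
    by (simp add: loop_multiplier_def)
  with c[OF B] r show ?thesis by simp
qed

end

section \<open>The homomorphism and the conformal measure\<close>

text \<open>For such a measure with open support every admissible word from a state of positive measure has positive measure.\<close>

locale invariant_measure_open_support = invariant_measure A M \<phi> f
  for A :: "'s::countable \<Rightarrow> 's \<Rightarrow> bool" and M :: "(nat \<Rightarrow> 's) measure"
    and \<phi> :: "(nat \<Rightarrow> 's) \<Rightarrow> 'g::ab_group_add" and f :: "'s \<Rightarrow> 'g" +
  assumes open_support: "openin (tms_topology A) (topological_support (tms_topology A) M)"
begin

text \<open>
  Since the support is open, it contains a whole nonempty cylinder of points starting with \<open>u\<close>, whose
  word extends to a loop at \<open>u\<close>. This loop followed by any other one has positive measure.
\<close>

lemma loop_positive:
  assumes u: "emeasure M (cyl A [u]) \<noteq> 0" and l: "walk A u l u"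
  shows "emeasure M (cyl A (l @ [u])) \<noteq> 0"
proof -
  let ?U = "topological_support (tms_topology A) M"
  have "cyl A [u] \<inter> ?U \<noteq> {}"
  proof
    assume disj: "cyl A [u] \<inter> ?U = {}"
    have "(\<Union>w\<in>{w. emeasure M (cyl A w) = 0}. cyl A w) \<in> null_sets M"
      by (intro null_sets_UN') auto
    moreover have "cyl A [u] \<subseteq> (\<Union>w\<in>{w. emeasure M (cyl A w) = 0}. cyl A w)"
    proof
      fix x assume x: "x \<in> cyl A [u]"
      then have "x \<notin> ?U" "x \<in> tms A"
        using disj by (auto simp: cyl_def)
      then obtain V where V: "openin (tms_topology A) V" "x \<in> V" "emeasure M V = 0"
        by (auto simp: topological_support_def topspace_tms)
      then obtain n where "cyl A (prefix (Suc n) x) \<subseteq> V"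
        using openin_tms_cyl by blast
      moreover have "V \<in> sets M"
        using V(1) sets_openin by (simp add: sets_M)
      ultimately have "emeasure M (cyl A (prefix (Suc n) x)) = 0"
        using V(3) emeasure_mono[of "cyl A (prefix (Suc n) x)" V M] by simp
      then show "x \<in> (\<Union>w\<in>{w. emeasure M (cyl A w) = 0}. cyl A w)"
        using cyl_prefix[OF \<open>x \<in> tms A\<close>] by blast
    qed
    ultimately have "cyl A [u] \<in> null_sets M"
      by (auto intro: null_sets_subset)
    with u show False by auto
  qed
  then obtain x where "x \<in> cyl A [u]" "x \<in> ?U"
    by blast
  then have x: "x \<in> tms A" "x 0 = u" "x \<in> ?U"
    by (auto simp: cyl_single_iff)
  obtain n where n: "cyl A (prefix (Suc n) x) \<subseteq> ?U"
    using openin_tms_cyl[OF open_support x(3)] by blast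
  define p where "p = prefix (Suc n) x"
  have p: "walk A u p (x (Suc n))"
    unfolding p_def using walk_prefix[OF x(1), of "Suc n"] by (simp only: x(2))
  obtain q where "walk A (x (Suc n)) q u"
    using walk_exists by blast
  with p have pq: "walk A u (p @ q) u"
    by (rule walk_append)
  let ?C = "cyl A ((p @ q) @ l @ [u])"
  obtain y where y: "y \<in> ?C"
    using walk_cyl_nonempty[OF walk_append[OF pq l]] by auto
  then have "y \<in> ?U"
    using n cyl_append_subset[of A p "q @ l @ [u]"] unfolding p_def[symmetric] by auto
  then have "emeasure M ?C > 0"
    using y openin_cyl[of "(p @ q) @ l @ [u]" A] unfolding topological_support_def by blast
  moreover have "emeasure M ?C = ennreal (loop_multiplier u (p @ q)) * emeasure M (cyl A (l @ [u]))"
  proof -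
    have "cyl A (l @ [u]) \<subseteq> cyl A [u]"
      using prepend_subset_cyl_walk[OF l order_refl] by (simp add: prepend_cyl)
    then show ?thesis
      using emeasure_loop[OF u pq, of "cyl A (l @ [u])"] by (simp add: prepend_cyl)
  qed
  ultimately show ?thesis by auto
qed

lemma walk_positive:
  assumes u: "emeasure M (cyl A [u]) \<noteq> 0" and w: "walk A u w t"
  shows "emeasure M (cyl A (w @ [t])) \<noteq> 0"
proof -
  obtain q where q: "walk A t q u"
    using walk_exists by blast
  have "prepend A w (cyl A (q @ [u])) \<subseteq> prepend A w (cyl A [t])"
    using prepend_subset_cyl_walk[OF q order_refl] by (intro prepend_mono) (simp add: prepend_cyl)
  then have "cyl A ((w @ q) @ [u]) \<subseteq> cyl A (w @ [t])"
    by (simp add: prepend_cyl)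
  then have "emeasure M (cyl A ((w @ q) @ [u])) \<le> emeasure M (cyl A (w @ [t]))"
    by (intro emeasure_mono) auto
  with loop_positive[OF u walk_append[OF w q]] show ?thesis
    by auto
qed

lemma support_eq:
  "topological_support (tms_topology A) M = {x \<in> tms A. emeasure M (cyl A [x 0]) \<noteq> 0}"
proof (intro equalityI subsetI)
  fix x assume "x \<in> topological_support (tms_topology A) M"
  then have x: "x \<in> tms A" and pos: "\<And>V. openin (tms_topology A) V \<Longrightarrow> x \<in> V \<Longrightarrow> emeasure M V > 0"
    by (auto simp: topological_support_def topspace_tms)
  have "emeasure M (cyl A [x 0]) > 0"
    using x by (intro pos openin_cyl) (auto simp: cyl_single_iff)
  with x show "x \<in> {x \<in> tms A. emeasure M (cyl A [x 0]) \<noteq> 0}"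
    by auto
next
  fix x assume x: "x \<in> {x \<in> tms A. emeasure M (cyl A [x 0]) \<noteq> 0}"
  have "emeasure M V > 0" if V: "openin (tms_topology A) V" "x \<in> V" for V
  proof -
    obtain n where n: "cyl A (prefix (Suc n) x) \<subseteq> V"
      using openin_tms_cyl[OF V] by blast
    have "emeasure M (cyl A (prefix n x @ [x n])) \<noteq> 0"
      using x walk_positive[OF _ walk_prefix[of x A n]] by auto
    moreover have "emeasure M (cyl A (prefix n x @ [x n])) \<le> emeasure M V"
      using n sets_openin[OF V(1)] by (intro emeasure_mono) (simp_all add: sets_M)
    ultimately show ?thesis
      by (auto simp: zero_less_iff_neq_zero)
  qed
  with x show "x \<in> topological_support (tms_topology A) M"
    by (auto simp: topological_support_def topspace_tms)
qed

lemma loop_multiplier_pos: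
  assumes "emeasure M (cyl A [u]) \<noteq> 0" "walk A u w u"
  shows "loop_multiplier u w > 0"
proof -
  have "emeasure M (cyl A (w @ [u])) = ennreal (loop_multiplier u w) * emeasure M (cyl A [u])"
    using emeasure_loop[OF assms, of "cyl A [u]"] by (simp add: prepend_cyl)
  with loop_positive[OF assms] show ?thesis
    by (metis ennreal_neg mult_zero_left not_le_imp_less)
qed

lemma loop_multiplier_append:
  assumes u: "emeasure M (cyl A [u]) \<noteq> 0" and v: "walk A u v u" and w: "walk A u w u"
  shows "loop_multiplier u (v @ w) = loop_multiplier u v * loop_multiplier u w"
proof -
  have "emeasure M (prepend A v (cyl A (w @ [u]))) = ennreal (loop_multiplier u v) * emeasure M (cyl A (w @ [u]))"
    using prepend_subset_cyl_walk[OF w order_refl] by (intro emeasure_loop[OF u v]) (simp_all add: prepend_cyl)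
  then have "measure M (cyl A ((v @ w) @ [u])) = loop_multiplier u v * measure M (cyl A (w @ [u]))"
    using loop_multiplier_pos[OF u v] by (simp add: prepend_cyl measure_def enn2real_mult)
  then show ?thesis
    by (simp add: loop_multiplier_def[of u "v @ w"] loop_multiplier_def[of u w])
qed

lemma loop_multiplier_cong:
  assumes u: "emeasure M (cyl A [u]) \<noteq> 0" and v: "walk A u v u" and w: "walk A u w u"
    and "length v = length w" "word_sum f v = word_sum f w"
  shows "loop_multiplier u v = loop_multiplier u w"
  using exchange[OF v w assms(4,5), of "cyl A [u]"] by (simp add: loop_multiplier_def measure_def prepend_cyl)

text \<open>
  The logarithm of the multiplier of a loop is an additive function of the pair consisting of its
  length and its sum, hence the restriction of a homomorphism of the product of the integers with
  the group.
\<close>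

lemma loop_multiplier_exponential:
  assumes u: "emeasure M (cyl A [u]) \<noteq> 0"
  obtains \<kappa> h where "Modules.additive h"
    "\<And>w. walk A u w u \<Longrightarrow> loop_multiplier u w = exp (- (real (length w) * \<kappa> + h (word_sum f w)))"
proof -
  define P where "P = {((int (length w), word_sum f w), - ln (loop_multiplier u w)) | w. walk A u w u}"
  obtain H where H: "Modules.additive H" "\<And>x r. (x, r) \<in> P \<Longrightarrow> H x = r"
  proof (rule additive_extension_from_submonoid[of P])
    have "emeasure M (cyl A [u]) = ennreal (measure M (cyl A [u]))"
      using emeasure_state_finite[of u] by (simp add: emeasure_eq_ennreal_measure less_top)
    with u have "loop_multiplier u [] = 1"
      by (auto simp: loop_multiplier_def)
    then show "0 \<in> P"
      unfolding P_def by (intro CollectI exI[of _ "[]"]) (simp add: zero_prod_def)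
    fix p q assume "p \<in> P" "q \<in> P"
    then obtain v w where vw: "p = ((int (length v), word_sum f v), - ln (loop_multiplier u v))"
        "q = ((int (length w), word_sum f w), - ln (loop_multiplier u w))"
        "walk A u v u" "walk A u w u"
      unfolding P_def by blast
    have "- ln (loop_multiplier u (v @ w)) = - ln (loop_multiplier u v) + - ln (loop_multiplier u w)"
      using loop_multiplier_pos[OF u vw(3)] loop_multiplier_pos[OF u vw(4)]
      by (simp add: loop_multiplier_append[OF u vw(3,4)] ln_mult_pos)
    then have "p + q = ((int (length (v @ w)), word_sum f (v @ w)), - ln (loop_multiplier u (v @ w)))"
      by (simp add: vw)
    with walk_append[OF vw(3,4)] show "p + q \<in> P"
      unfolding P_def by blast
  next
    fix x r s assume "(x, r) \<in> P" "(x, s) \<in> P"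
    then obtain v w where
        v: "x = (int (length v), word_sum f v)" "r = - ln (loop_multiplier u v)" "walk A u v u"
        and w: "x = (int (length w), word_sum f w)" "s = - ln (loop_multiplier u w)" "walk A u w u"
      unfolding P_def by blast
    have "loop_multiplier u v = loop_multiplier u w"
      by (rule loop_multiplier_cong[OF u v(3) w(3)]) (use v(1) w(1) in simp_all)
    then show "r = s"
      by (simp add: v w)
  qed (use that in blast)
  interpret H: Modules.additive H by (rule H(1))
  have H_int: "H (int n, 0) = real n * H (1, 0)" for n
  proof (induction n)
    case (Suc n)
    have "(int (Suc n), 0 :: 'g) = (int n, 0) + (1, 0)"
      by simp
    then show ?case
      by (simp only: H.add Suc) (simp add: algebra_simps)
  qed (use H.zero in \<open>simp add: zero_prod_def\<close>)
  show ?thesis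
  proof (rule that)
    show "Modules.additive (\<lambda>z. H (0, z))"
      using H.add[of "(0, _)" "(0, _)"] by (simp add: Modules.additive_def)
    fix w assume w: "walk A u w u"
    then have "H (int (length w), word_sum f w) = - ln (loop_multiplier u w)"
      using H(2) unfolding P_def by blast
    moreover have "H (int (length w), word_sum f w) = H (int (length w), 0) + H (0, word_sum f w)"
      by (simp flip: H.add)
    ultimately have "- (real (length w) * H (1, 0) + H (0, word_sum f w)) = ln (loop_multiplier u w)"
      by (simp add: H_int)
    then show "loop_multiplier u w = exp (- (real (length w) * H (1, 0) + H (0, word_sum f w)))"
      using loop_multiplier_pos[OF u w] by simp
  qed
qed


text \<open>
  The multiplier of words for the conformal measure, where \<open>\<kappa>\<close> is the logarithm of the constant \<open>c\<close>. On
  the loops at a base state it is the multiplier of \<open>M\<close>, by \<open>loop_multiplier_exponential\<close>.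
\<close>

definition weight :: "real \<Rightarrow> ('g \<Rightarrow> real) \<Rightarrow> 's list \<Rightarrow> real" where
  "weight \<kappa> h w = exp (- (real (length w) * \<kappa> + h (word_sum f w)))"

lemma weight_pos [simp]: "weight \<kappa> h w > 0"
  by (simp add: weight_def)

lemma weight_nonneg [simp]: "weight \<kappa> h w \<ge> 0"
  by (simp add: weight_def)

lemma weight_append:
  assumes "Modules.additive h"
  shows "weight \<kappa> h (v @ w) = weight \<kappa> h v * weight \<kappa> h w"
  using Modules.additive.add[OF assms] by (simp add: weight_def algebra_simps flip: exp_add)

lemma weight_Nil:
  assumes "Modules.additive h"
  shows "weight \<kappa> h [] = 1"
  using Modules.additive.zero[OF assms] by (simp add: weight_def)

text \<open>
  The conformal measure on the whole space is obtained from the restriction of \<open>M\<close> to the points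
  starting with \<open>u\<close> by prepending the words, with their weights, that lead to \<open>u\<close> for the first time.
  Words leading from \<open>u\<close> to another state \<open>t\<close>, possibly of \<open>M\<close>-measure zero, then have the expected
  multiplier, because almost every point starting with such a word returns to \<open>u\<close>.
\<close>

lemma conformal_measure_exists:
  assumes u: "emeasure M (cyl A [u]) \<noteq> 0" and h: "Modules.additive h"
    and loop: "\<And>w. walk A u w u \<Longrightarrow> loop_multiplier u w = weight \<kappa> h w"
  obtains \<mu> where "sets \<mu> = sets M"
    "\<And>q t B. walk A u q t \<Longrightarrow> B \<in> sets M \<Longrightarrow> B \<subseteq> cyl A [t] \<Longrightarrow>
      emeasure M (prepend A q B) = ennreal (weight \<kappa> h q) * emeasure \<mu> B"
proof -
  let ?W = "weight \<kappa> h"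
  define \<rho> where "\<rho> r = scale_measure (ennreal (?W r))
    (distr (restrict_space M (pull A r (tms A) \<inter> cyl A [u])) M ((\<frown>) r))" for r
  have \<rho>: "emeasure (\<rho> r) B = ennreal (?W r) * emeasure M (pull A r B \<inter> cyl A [u])"
    if B: "B \<in> sets M" for r B
  proof -
    let ?C = "pull A r (tms A) \<inter> cyl A [u]"
    have C: "?C \<in> sets M"
      by (intro sets.Int) auto
    have "(\<lambda>x. r \<frown> suffix 0 x) \<in> measurable (restrict_space (tms_borel A) ?C) (tms_borel A)"
      by (rule measurable_conc_suffix) (auto simp: pull_def)
    moreover have "measurable (restrict_space (tms_borel A) ?C) (tms_borel A) = measurable (restrict_space M ?C) M"
      by (intro measurable_cong_sets) (auto simp: sets_M intro!: sets_restrict_space_cong)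
    ultimately have "(\<frown>) r \<in> measurable (restrict_space M ?C) M"
      by simp
    then have "emeasure (distr (restrict_space M ?C) M ((\<frown>) r)) B
        = emeasure (restrict_space M ?C) ((\<frown>) r -` B \<inter> space (restrict_space M ?C))"
      using B by (intro emeasure_distr)
    also have "\<dots> = emeasure M ((\<frown>) r -` B \<inter> space (restrict_space M ?C))"
      using C by (intro emeasure_restrict_space) (auto simp: space_restrict_space)
    also have "(\<frown>) r -` B \<inter> space (restrict_space M ?C) = pull A r B \<inter> cyl A [u]"
      using sets.sets_into_space[OF B] by (auto simp: space_restrict_space space_M pull_def)
    finally show ?thesis
      by (simp add: \<rho>_def)
  qed
  obtain \<mu> where \<mu>: "sets \<mu> = sets M"
      "\<And>B. B \<in> sets M \<Longrightarrow> emeasure \<mu> B = (\<integral>\<^sup>+r. emeasure (\<rho> r) B \<partial>count_space {r. u \<notin> set r})"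
    by (rule sum_measure_exists[of \<rho> M "{r. u \<notin> set r}"]) (auto simp: \<rho>_def)
  show ?thesis
  proof (rule that[OF \<mu>(1)])
    fix q t B assume q: "walk A u q t" and B: "B \<in> sets M" "B \<subseteq> cyl A [t]"
    have part: "emeasure M (prepend A q (B \<inter> cyl A (r @ [u]))) = ennreal (?W q) * emeasure (\<rho> r) B" for r
    proof -
      let ?D = "pull A r B \<inter> cyl A [u]"
      have D: "?D \<in> sets M"
        using B by (intro sets.Int) auto
      have "prepend A r ?D = prepend A r (pull A r B) \<inter> prepend A r (cyl A [u])"
        by (auto simp: prepend_def)
      also have "\<dots> = B \<inter> cyl A (r @ [u])"
        unfolding prepend_pull prepend_cyl using cyl_append_subset by blast
      finally have eq: "B \<inter> cyl A (r @ [u]) = prepend A r ?D" ..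
      show ?thesis
      proof (cases "?D = {}")
        case True
        then have "prepend A r ?D = {}"
          by (auto simp: prepend_def)
        with True show ?thesis
          by (simp add: eq \<rho>[OF B(1)] prepend_def)
      next
        case False
        then obtain z where "z \<in> ?D"
          by blast
        then have z: "r \<frown> z \<in> B" "z \<in> tms A" "z 0 = u"
          by (auto simp: pull_def cyl_single_iff)
        then have "r \<frown> z \<in> tms A" "(r \<frown> z) 0 = t"
          using B(2) by (auto simp: cyl_single_iff)
        with z have "walk A t r u"
          by (auto simp: conc_in_tms_walk conc_nth_0)
        then have w: "walk A u (q @ r) u"
          using q by (intro walk_append)
        have "emeasure M (prepend A q (prepend A r ?D)) = ennreal (?W (q @ r)) * emeasure M ?D"
          unfolding prepend_prepend using emeasure_loop[OF u w D] loop[OF w] by simp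
        then show ?thesis
          by (simp add: eq \<rho>[OF B(1)] weight_append[OF h] ennreal_mult mult.assoc)
      qed
    qed
    have "emeasure M (prepend A q B)
        = (\<integral>\<^sup>+r. ennreal (?W q) * emeasure (\<rho> r) B \<partial>count_space {r. u \<notin> set r})"
      using emeasure_prepend_first_visit[OF B(1) prepend_subset_cyl_walk[OF q B(2)]] by (simp add: part)
    also have "\<dots> = ennreal (?W q) * emeasure \<mu> B"
      using B by (simp add: nn_integral_cmult \<mu>(2))
    finally show "emeasure M (prepend A q B) = ennreal (?W q) * emeasure \<mu> B" .
  qed
qed

lemma emeasure_partition:
  assumes N: "sets N = sets M" and B: "B \<in> sets M"
  shows "emeasure N B = (\<integral>\<^sup>+t. emeasure N (B \<inter> cyl A [t]) \<partial>count_space UNIV)"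
proof -
  have "B = (\<Union>t. B \<inter> cyl A [t])"
    using sets.sets_into_space[OF B] by (auto simp: space_M cyl_single_iff)
  then have "emeasure N B = emeasure N (\<Union>t. B \<inter> cyl A [t])"
    by simp
  also have "\<dots> = (\<integral>\<^sup>+t. emeasure N (B \<inter> cyl A [t]) \<partial>count_space UNIV)"
  proof (rule emeasure_UN_countable)
    show "B \<inter> cyl A [t] \<in> sets N" for t
      unfolding N by (intro sets.Int B sets_M_cyl)
    show "disjoint_family_on (\<lambda>t. B \<inter> cyl A [t]) UNIV"
      by (auto simp: disjoint_family_on_def cyl_single_iff)
  qed (rule countableI_type)
  finally show ?thesis .
qed

text \<open>
  The hypothesis \<open>link\<close> says that every state of positive measure communicates with the base state \<open>u\<close>
  under the tail relation; it makes \<open>\<mu>\<close> agree with \<open>M\<close> on these states.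
\<close>

theorem conformal_markov_extension:
  assumes u: "emeasure M (cyl A [u]) \<noteq> 0"
    and link: "\<And>t. emeasure M (cyl A [t]) \<noteq> 0 \<Longrightarrow>
      \<exists>v y. walk A t v u \<and> walk A u y u \<and> length v = length y \<and> word_sum f v = word_sum f y"
  shows "\<exists>(h :: 'g \<Rightarrow> real) (c :: real) \<mu>.
    Modules.additive h \<and> c > 0 \<and> \<mu> \<in> partition_finite_measures A \<and> markov_measure A \<mu> \<and>
    is_shift_RN_deriv A \<mu> (\<lambda>x. ennreal (c * exp (h (\<phi> x)))) \<and>
    (\<forall>B\<in>sets M. emeasure M B = emeasure \<mu> (B \<inter> topological_support (tms_topology A) M))"
proof -
  obtain \<kappa> h where h: "Modules.additive h"
      and loop: "\<And>w. walk A u w u \<Longrightarrow> loop_multiplier u w = weight \<kappa> h w"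
  proof (rule loop_multiplier_exponential[OF u])
    fix h \<kappa>
    assume "Modules.additive h"
      and "\<And>w. walk A u w u \<Longrightarrow> loop_multiplier u w = exp (- (real (length w) * \<kappa> + h (word_sum f w)))"
    then show ?thesis
      by (intro that[of h \<kappa>]) (simp_all add: weight_def)
  qed
  obtain \<mu> where sets_\<mu>: "sets \<mu> = sets M"
      and \<mu>: "\<And>q t B. walk A u q t \<Longrightarrow> B \<in> sets M \<Longrightarrow> B \<subseteq> cyl A [t] \<Longrightarrow>
        emeasure M (prepend A q B) = ennreal (weight \<kappa> h q) * emeasure \<mu> B"
    using conformal_measure_exists[OF u h loop] by blast
  let ?W = "weight \<kappa> h"
  have space_\<mu>: "space \<mu> = tms A"
    using sets_eq_imp_space_eq[OF sets_\<mu>] space_M by simp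
  \<comment> \<open>A walk from \<open>s\<close> is preceded by a walk from \<open>u\<close> to \<open>s\<close>, whose weight cancels.\<close>
  have prepend_weight: "emeasure \<mu> (prepend A w B) = ennreal (?W w) * emeasure \<mu> B"
    if w: "walk A s w t" and B: "B \<in> sets M" "B \<subseteq> cyl A [t]" for s w t B
  proof -
    obtain q where q: "walk A u q s"
      using walk_exists by blast
    have "ennreal (?W q) * emeasure \<mu> (prepend A w B) = emeasure M (prepend A q (prepend A w B))"
      using \<mu>[OF q, of "prepend A w B"] prepend_subset_cyl_walk[OF w B(2)] B by simp
    also have "\<dots> = ennreal (?W q) * (ennreal (?W w) * emeasure \<mu> B)"
      using \<mu>[OF walk_append[OF q w] B] by (simp add: prepend_prepend weight_append[OF h] ennreal_mult mult.assoc)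
    finally show ?thesis
      by (rule ennreal_mult_left_cancel) simp
  qed
  have pos: "emeasure \<mu> (cyl A [t]) \<noteq> 0" and fin: "emeasure \<mu> (cyl A [t]) < \<infinity>" for t
  proof -
    obtain q where q: "walk A u q t"
      using walk_exists by blast
    have eq: "emeasure M (cyl A (q @ [t])) = ennreal (?W q) * emeasure \<mu> (cyl A [t])"
      using \<mu>[OF q, of "cyl A [t]"] by (simp add: prepend_cyl)
    with walk_positive[OF u q] show "emeasure \<mu> (cyl A [t]) \<noteq> 0"
      by auto
    have "emeasure M (cyl A (q @ [t])) \<le> emeasure M (cyl A [u])"
      using prepend_subset_cyl_walk[OF q order_refl] by (intro emeasure_mono) (simp_all add: prepend_cyl)
    also have "\<dots> < \<infinity>"
      by (rule emeasure_state_finite)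
    finally show "emeasure \<mu> (cyl A [t]) < \<infinity>"
      unfolding eq using weight_pos[of \<kappa> h q] by (auto simp: ennreal_mult_less_top simp del: weight_pos)
  qed
  have step: "emeasure \<mu> (prepend A [s] B) = ennreal (?W [s]) * emeasure \<mu> B"
    if B: "B \<in> sets M" "\<And>y. y \<in> B \<Longrightarrow> A s (y 0)" for s B
  proof -
    have part: "emeasure \<mu> (prepend A [s] (B \<inter> cyl A [t])) = ennreal (?W [s]) * emeasure \<mu> (B \<inter> cyl A [t])" for t
    proof (cases "A s t")
      case True
      then show ?thesis
        using B(1) by (intro prepend_weight[of s _ t]) (auto simp: walk_Cons intro!: sets.Int)
    next
      case False
      then have "B \<inter> cyl A [t] = {}"
        using B(2) by (auto simp: cyl_single_iff)
      then show ?thesis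
        by (simp add: prepend_def)
    qed
    have "prepend A [s] B = (\<Union>t. prepend A [s] (B \<inter> cyl A [t]))"
      using sets.sets_into_space[OF B(1)] by (auto simp: prepend_def space_M cyl_single_iff suffix_in_tms)
    then have "emeasure \<mu> (prepend A [s] B) = emeasure \<mu> (\<Union>t. prepend A [s] (B \<inter> cyl A [t]))"
      by simp
    also have "\<dots> = (\<integral>\<^sup>+t. emeasure \<mu> (prepend A [s] (B \<inter> cyl A [t])) \<partial>count_space UNIV)"
    proof (rule emeasure_UN_countable)
      show "prepend A [s] (B \<inter> cyl A [t]) \<in> sets \<mu>" for t
        unfolding sets_\<mu> by (intro sets_M_prepend sets.Int B(1) sets_M_cyl)
      show "disjoint_family_on (\<lambda>t. prepend A [s] (B \<inter> cyl A [t])) UNIV"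
        by (auto simp: disjoint_family_on_def prepend_def cyl_single_iff)
    qed (rule countableI_type)
    also have "\<dots> = ennreal (?W [s]) * (\<integral>\<^sup>+t. emeasure \<mu> (B \<inter> cyl A [t]) \<partial>count_space UNIV)"
      by (simp add: part nn_integral_cmult)
    finally show ?thesis
      using emeasure_partition[OF sets_\<mu> B(1)] by simp
  qed
  \<comment> \<open>If \<open>t\<close> has positive \<open>M\<close>-measure, the loops at \<open>t\<close> have multipliers as well. Since \<open>t\<close> is linked to \<open>u\<close> by
    a word \<open>v\<close> with the expected multiplier, the measures \<open>M\<close> and \<open>\<mu>\<close> are proportional on \<open>t\<close>.\<close>
  have agree: "emeasure \<mu> B = emeasure M B"
    if t: "emeasure M (cyl A [t]) \<noteq> 0" and B: "B \<in> sets M" "B \<subseteq> cyl A [t]" for t B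
  proof -
    obtain v y where v: "walk A t v u" and y: "walk A u y u"
        and vy: "length v = length y" "word_sum f v = word_sum f y"
      using link[OF t] by blast
    have M_v: "emeasure M (prepend A v D) = ennreal (?W v) * emeasure M D"
      if D: "D \<in> sets M" "D \<subseteq> cyl A [u]" for D
    proof -
      have "emeasure M (prepend A v D) = emeasure M (prepend A y D)"
        by (rule exchange[OF v y vy D])
      also have "\<dots> = ennreal (?W y) * emeasure M D"
        using emeasure_loop[OF u y D] loop[OF y] by simp
      also have "?W y = ?W v"
        using vy by (simp add: weight_def)
      finally show ?thesis .
    qed
    obtain q where q: "walk A u q t"
      using walk_exists by blast
    have vq: "walk A t (v @ q) t"
      using v q by (rule walk_append)
    let ?l = "loop_multiplier t (v @ q)"
    have rel: "ennreal ?l * emeasure M D = ennreal (?W v * ?W q) * emeasure \<mu> D"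
      if D: "D \<in> sets M" "D \<subseteq> cyl A [t]" for D
    proof -
      have "ennreal ?l * emeasure M D = emeasure M (prepend A v (prepend A q D))"
        using emeasure_loop[OF t vq D] by (simp add: prepend_prepend)
      also have "\<dots> = ennreal (?W v) * emeasure M (prepend A q D)"
        using D prepend_subset_cyl_walk[OF q D(2)] by (intro M_v) auto
      also have "\<dots> = ennreal (?W v * ?W q) * emeasure \<mu> D"
        using \<mu>[OF q D] by (simp add: ennreal_mult mult.assoc)
      finally show ?thesis .
    qed
    \<comment> \<open>The two multipliers are equal because \<open>M\<close> and \<open>\<mu>\<close> agree on the points starting with the word \<open>v u\<close>.\<close>
    let ?D = "cyl A (v @ [u])"
    have D: "?D \<in> sets M" "?D \<subseteq> cyl A [t]"
      using prepend_subset_cyl_walk[OF v order_refl] by (auto simp: prepend_cyl)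
    have "emeasure \<mu> (cyl A [u]) = emeasure M (cyl A [u])"
      using \<mu>[of "[]" u "cyl A [u]"] cyl_subset_tms[of A "[u]"] by (simp add: weight_Nil[OF h] prepend_Nil)
    then have "emeasure \<mu> ?D = emeasure M ?D"
      using M_v[of "cyl A [u]"] prepend_weight[OF v, of "cyl A [u]"] by (simp add: prepend_cyl)
    moreover have "emeasure M ?D \<noteq> 0" "emeasure M ?D < \<infinity>"
      using walk_positive[OF t v] emeasure_mono[OF D(2), of M] emeasure_state_finite[of t]
      by (auto intro: le_less_trans)
    then obtain m where m: "emeasure M ?D = ennreal m" "m > 0"
      by (cases "emeasure M ?D") (auto simp: less_le)
    ultimately have "ennreal (?l * m) = ennreal (?W v * ?W q * m)"
      using rel[OF D] by (simp add: ennreal_mult'')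
    then have "?l = ?W v * ?W q"
      using m loop_multiplier_pos[OF t vq] by (subst (asm) ennreal_inj) auto
    then have "ennreal ?l * emeasure \<mu> B = ennreal ?l * emeasure M B"
      using rel[OF B] by simp
    then show ?thesis
      by (rule ennreal_mult_left_cancel) (rule loop_multiplier_pos[OF t vq])
  qed
  have "sigma_finite_measure \<mu>"
  proof
    show "\<exists>C. countable C \<and> C \<subseteq> sets \<mu> \<and> \<Union> C = space \<mu> \<and> (\<forall>a\<in>C. emeasure \<mu> a \<noteq> \<infinity>)"
      using fin sets_\<mu>
      by (intro exI[of _ "range (\<lambda>t. cyl A [t])"]) (auto simp: space_\<mu> cyl_single_iff less_top)
  qed
  then have partition_finite: "\<mu> \<in> partition_finite_measures A"
    using fin by (auto simp: partition_finite_measures_def tms_partition_def sets_\<mu> sets_M)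
  define m where "m t = measure \<mu> (cyl A [t])" for t
  have m: "emeasure \<mu> (cyl A [t]) = ennreal (m t)" "m t > 0" for t
  proof -
    show eq: "emeasure \<mu> (cyl A [t]) = ennreal (m t)"
      using fin[of t] by (simp add: m_def emeasure_eq_ennreal_measure less_top)
    show "m t > 0"
      using pos[of t] unfolding eq by (simp add: m_def zero_less_measure_iff)
  qed
  \<comment> \<open>The transition probabilities; they sum to one because a point starting with \<open>s\<close> has some second letter.\<close>
  define p where "p s t = (if A s t then ?W [s] * m t / m s else 0)" for s t
  have mp: "ennreal (m s) * ennreal (p s t) = (if A s t then ennreal (?W [s]) * ennreal (m t) else 0)" for s t
  proof -
    have "m s * p s t = (if A s t then ?W [s] * m t else 0)"
      using m(2)[of s] by (simp add: p_def)
    moreover have "ennreal (m s) * ennreal (p s t) = ennreal (m s * p s t)"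
      using m(2)[of s] by (simp add: ennreal_mult')
    ultimately show ?thesis
      by (simp add: ennreal_mult')
  qed
  have cyl_Cons: "emeasure \<mu> (cyl A (s # t # w)) = (if A s t then ennreal (?W [s]) * emeasure \<mu> (cyl A (t # w)) else 0)"
    for s t w
  proof -
    have eq: "cyl A (s # t # w) = prepend A [s] (cyl A (t # w))"
      by (simp add: prepend_cyl)
    have sub: "cyl A (t # w) \<subseteq> cyl A [t]"
      using cyl_append_subset[of A "[t]" w] by simp
    show ?thesis
    proof (cases "A s t")
      case True
      then show ?thesis
        unfolding eq using sub by (subst prepend_weight[of s "[s]" t]) (auto simp: walk_Cons)
    next
      case False
      then have "prepend A [s] (cyl A (t # w)) = {}"
        using prepend_empty_if_not_walk[OF sub, of "[s]"] by (simp add: walk_Cons)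
      with False show ?thesis
        unfolding eq by simp
    qed
  qed
  have "markov_measure A \<mu>"
    unfolding markov_measure_def
  proof (intro exI[of _ p] conjI allI impI)
    show "stochastic_matrix p"
      unfolding stochastic_matrix_def
    proof (intro conjI allI)
      show "p s t \<ge> 0" for s t
        using m(2) by (auto simp: p_def less_imp_le)
      fix s
      have "ennreal (m s) * (\<integral>\<^sup>+t. ennreal (p s t) \<partial>count_space UNIV)
          = (\<integral>\<^sup>+t. ennreal (m s) * ennreal (p s t) \<partial>count_space UNIV)"
        by (simp add: nn_integral_cmult)
      also have "\<dots> = (\<integral>\<^sup>+t. emeasure \<mu> (cyl A [s, t]) \<partial>count_space UNIV)"
        by (simp only: mp cyl_Cons m(1))
      also have "\<dots> = (\<integral>\<^sup>+t. emeasure \<mu> (prepend A [s] (cyl A [t])) \<partial>count_space UNIV)"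
        by (simp add: prepend_cyl)
      also have "\<dots> = emeasure \<mu> (\<Union>t. prepend A [s] (cyl A [t]))"
      proof (rule emeasure_UN_countable[symmetric])
        show "disjoint_family_on (\<lambda>t. prepend A [s] (cyl A [t])) UNIV"
          by (auto simp: disjoint_family_on_def prepend_def cyl_single_iff)
      qed (auto simp: sets_\<mu>)
      also have "(\<Union>t. prepend A [s] (cyl A [t])) = cyl A [s]"
        by (auto simp: prepend_def cyl_single_iff suffix_in_tms)
      finally have "ennreal (m s) * (\<integral>\<^sup>+t. ennreal (p s t) \<partial>count_space UNIV) = ennreal (m s) * ennreal 1"
        by (simp add: m)
      then have "(\<integral>\<^sup>+t. ennreal (p s t) \<partial>count_space UNIV) = ennreal 1"
        by (rule ennreal_mult_left_cancel) (rule m(2))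
      then show "(p s has_sum 1) UNIV"
        using \<open>\<And>t s. p s t \<ge> 0\<close> by (intro has_sum_of_nn_integral) auto
    qed
    fix w :: "'s list" assume "w \<noteq> []"
    then show "emeasure \<mu> (cyl A w) = emeasure \<mu> (cyl A [hd w]) *
        (\<Prod>i<length w - 1. ennreal (p (w ! i) (w ! Suc i)))"
    proof (induction w rule: list_nonempty_induct)
      case (cons s w)
      then obtain t v where w: "w = t # v"
        by (cases w) auto
      have "(\<Prod>i<length (s # w) - 1. ennreal (p ((s # w) ! i) ((s # w) ! Suc i)))
          = ennreal (p s t) * (\<Prod>i<length w - 1. ennreal (p (w ! i) (w ! Suc i)))"
        by (simp add: w prod.lessThan_Suc_shift del: prod.lessThan_Suc)
      then have "emeasure \<mu> (cyl A [s]) * (\<Prod>i<length (s # w) - 1. ennreal (p ((s # w) ! i) ((s # w) ! Suc i)))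
          = (if A s t then ennreal (?W [s]) * ennreal (m t) else 0) * (\<Prod>i<length w - 1. ennreal (p (w ! i) (w ! Suc i)))"
        unfolding m(1) mp[symmetric] by (simp only: mult.assoc)
      also have "\<dots> = emeasure \<mu> (cyl A (s # w))"
        using cons.IH by (simp add: w cyl_Cons m(1) mult.assoc)
      finally show ?case
        by simp
    qed simp
  qed
  moreover have "is_shift_RN_deriv A \<mu> (\<lambda>x. ennreal (exp \<kappa> * exp (h (\<phi> x))))"
    unfolding is_shift_RN_deriv_def
  proof (intro conjI ballI impI)
    have "(\<lambda>x. x 0) \<in> measurable \<mu> (count_space UNIV)"
    proof (rule measurable_count_space_eq_countable[THEN iffD2])
      show "(\<lambda>x. x 0) \<in> space \<mu> \<rightarrow> UNIV \<and> (\<forall>s\<in>UNIV. (\<lambda>x. x 0) -` {s} \<inter> space \<mu> \<in> sets \<mu>)"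
      proof (intro conjI ballI)
        fix s :: 's
        have "(\<lambda>x. x 0) -` {s} \<inter> space \<mu> = cyl A [s]"
          by (auto simp: space_\<mu> cyl_single_iff)
        then show "(\<lambda>x. x 0) -` {s} \<inter> space \<mu> \<in> sets \<mu>"
          by (simp add: sets_\<mu>)
      qed simp
    qed simp
    then have "(\<lambda>x. ennreal (exp \<kappa> * exp (h (f (x 0))))) \<in> borel_measurable \<mu>"
      by (rule measurable_compose) simp
    then show "(\<lambda>x. ennreal (exp \<kappa> * exp (h (\<phi> x)))) \<in> borel_measurable \<mu>"
      by (rule measurable_cong[THEN iffD1, rotated]) (simp add: space_\<mu> phi)
    fix a B assume "a \<in> tms_partition A" and B: "B \<in> sets \<mu>" "B \<subseteq> a"
    then obtain s where a: "a = cyl A [s]"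
      by (auto simp: tms_partition_def)
    have pull_B: "pull A [s] B = shift ` B"
    proof (intro equalityI subsetI)
      fix y assume "y \<in> pull A [s] B"
      then have "s ## y \<in> B"
        by (simp add: pull_def)
      then show "y \<in> shift ` B"
        by (rule image_eqI[rotated]) (simp add: shift_def)
    next
      fix y assume "y \<in> shift ` B"
      then obtain x where x: "x \<in> B" "y = shift x" by auto
      then have "s ## y = x" "x \<in> tms A"
        using B(2) build_first[of x] by (auto simp: a cyl_single_iff shift_def suffix_def)
      with x suffix_in_tms[of x A 1] show "y \<in> pull A [s] B"
        by (auto simp: pull_def shift_def suffix_def)
    qed
    have pull_sets: "pull A [s] B \<in> sets M"
      using B by (simp add: sets_\<mu>)
    have prepend_pull_B: "prepend A [s] (pull A [s] B) = B"
      using B(2) by (auto simp: prepend_pull a)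
    have "emeasure \<mu> B = ennreal (?W [s]) * emeasure \<mu> (shift ` B)"
    proof -
      have "emeasure \<mu> (prepend A [s] (pull A [s] B)) = ennreal (?W [s]) * emeasure \<mu> (pull A [s] B)"
        using sets.sets_into_space[OF B(1)]
        by (intro step pull_sets) (auto simp: pull_def space_\<mu> build_in_tms)
      then show ?thesis
        by (simp only: prepend_pull_B) (simp only: pull_B)
    qed
    moreover have "(\<integral>\<^sup>+x\<in>B. ennreal (exp \<kappa> * exp (h (\<phi> x))) \<partial>\<mu>)
        = (\<integral>\<^sup>+x. ennreal (exp \<kappa> * exp (h (f s))) * indicator B x \<partial>\<mu>)"
      using B(2) by (intro nn_integral_cong) (auto simp: a cyl_single_iff phi indicator_def)
    moreover have "\<dots> = ennreal (exp \<kappa> * exp (h (f s))) * emeasure \<mu> B"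
      using B(1) by (rule nn_integral_cmult_indicator)
    moreover have "ennreal (exp \<kappa> * exp (h (f s))) * ennreal (?W [s]) = 1"
      by (simp add: weight_def flip: ennreal_mult exp_add)
    ultimately show "emeasure \<mu> (shift ` B) = (\<integral>\<^sup>+x\<in>B. ennreal (exp \<kappa> * exp (h (\<phi> x))) \<partial>\<mu>)"
      by (simp flip: mult.assoc)
  qed
  moreover have "emeasure M B = emeasure \<mu> (B \<inter> topological_support (tms_topology A) M)"
    if B: "B \<in> sets M" for B
  proof -
    let ?U = "topological_support (tms_topology A) M"
    have U: "?U \<in> sets M"
      using sets_openin[OF open_support] by (simp add: sets_M)
    have part: "emeasure M (B \<inter> cyl A [t]) = emeasure \<mu> (B \<inter> ?U \<inter> cyl A [t])" for t
    proof (cases "emeasure M (cyl A [t]) = 0")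
      case True
      have "emeasure M (B \<inter> cyl A [t]) \<le> emeasure M (cyl A [t])"
        by (intro emeasure_mono) auto
      moreover have "B \<inter> ?U \<inter> cyl A [t] = {}"
        using True by (auto simp: support_eq cyl_single_iff)
      ultimately show ?thesis
        using True by simp
    next
      case False
      have "B \<inter> ?U \<inter> cyl A [t] = B \<inter> cyl A [t]"
        using False by (auto simp: support_eq cyl_single_iff)
      then show ?thesis
        using agree[OF False, of "B \<inter> cyl A [t]"] B sets.Int[OF B sets_M_cyl[of "[t]"]] by simp
    qed
    show ?thesis
      using emeasure_partition[OF refl B] emeasure_partition[OF sets_\<mu> sets.Int[OF B U]] by (simp add: part)
  qed
  ultimately show ?thesis
    using h partition_finite by (intro exI[of _ h] exI[of _ "exp \<kappa>"] exI[of _ \<mu>]) simp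
qed

end

section \<open>States linked by the tail relation\<close>

text \<open>An \<open>\<alpha>\<close>-measurable function is a function of the first coordinate.\<close>

lemma partition_measurable_state_function:
  assumes "partition_measurable A \<phi>"
  obtains f where "\<And>x. x \<in> tms A \<Longrightarrow> \<phi> x = f (x 0)"
proof -
  have "\<exists>c. \<forall>x\<in>cyl A [s]. \<phi> x = c" for s
    using assms unfolding partition_measurable_def tms_partition_def constant_on_def by blast
  then obtain f where "\<And>s x. x \<in> cyl A [s] \<Longrightarrow> \<phi> x = f s"
    by metis
  then show ?thesis
    using that by (auto simp: cyl_single_iff)
qed

lemma word_sum_coboundary:
  fixes f b \<gamma> :: "'s \<Rightarrow> 'g::ab_group_add"
  assumes "\<And>s t. A s t \<Longrightarrow> f s = a + \<gamma> s - \<gamma> t + b s"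
    and "walk A s w t"
  shows "word_sum f w = multiple (length w) a + \<gamma> s - \<gamma> t + word_sum b w"
  using assms(2)
proof (induction w arbitrary: s)
  case (Cons r w)
  then have "s = r" "A s (hd (w @ [t]))" "walk A (hd (w @ [t])) w t"
    by (auto simp: walk_Cons)
  note eqs = Cons.IH[OF this(3)] assms(1)[OF this(2)] \<open>s = r\<close>
  show ?case
    by (simp add: eqs(1,2) multiple_Suc algebra_simps flip: eqs(3))
qed simp

text \<open>
  If \<open>f\<close> is, up to a constant and the coboundary of \<open>\<gamma>\<close>, an aperiodic function \<open>b\<close> with values in \<open>F\<close>,
  then two states communicate under the tail relation as soon as their values under \<open>\<gamma>\<close> differ by
  an element of \<open>F\<close>.
\<close>

lemma (in mixing_shift) linked_states:
  fixes f b \<gamma> :: "'s \<Rightarrow> 'g::ab_group_add"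
  assumes f: "\<And>s t. A s t \<Longrightarrow> f s = a + \<gamma> s - \<gamma> t + b s"
    and F: "add_subgroup F" "\<And>s. b s \<in> F"
    and gen: "F \<subseteq> group_closure {word_sum b X - word_sum b Y | X Y x y.
      walk A x X x \<and> walk A y Y y \<and> length X = length Y}"
    and st: "\<gamma> t - \<gamma> u \<in> F"
  shows "\<exists>v y. walk A t v u \<and> walk A u y u \<and> length v = length y \<and> word_sum f v = word_sum f y"
proof -
  obtain v where v: "walk A t v u"
    using walk_exists by blast
  have "word_sum b v \<in> F"
    using F by (induction v) (auto simp: add_subgroup_def)
  then have "\<gamma> t - \<gamma> u + word_sum b v \<in> F"
    using st F(1) unfolding add_subgroup_def by blast
  from loop_differences_length[OF F gen this, of u "length v"] obtain y x
    where yx: "walk A u y u" "walk A u x u" "length y = length x + length v"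
      "word_sum b y - word_sum b x = \<gamma> t - \<gamma> u + word_sum b v"
    by blast
  have len: "length (v @ x) = length y"
    using yx(3) by simp
  have "word_sum b y = \<gamma> t - \<gamma> u + word_sum b v + word_sum b x"
    using yx(4) by (simp add: algebra_simps)
  moreover have "word_sum f w = multiple (length w) a + \<gamma> s - \<gamma> u + word_sum b w" if "walk A s w u" for s w
    using f that by (rule word_sum_coboundary)
  note this[OF yx(1)] this[OF walk_append[OF v yx(2)]]
  ultimately have "word_sum f (v @ x) = word_sum f y"
    unfolding len by simp
  with len yx(1) walk_append[OF v yx(2)] show ?thesis
    by blast
qed

theorem theorem5p1:
  fixes A :: "'s::countable \<Rightarrow> 's \<Rightarrow> bool"
    and F :: "'g::{topological_ab_group_add, polish_space} set"
    and \<phi> g \<phi>' :: "(nat \<Rightarrow> 's) \<Rightarrow> 'g"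
    and a :: 'g
    and \<nu> :: "(nat \<Rightarrow> 's) measure"
    and U :: "(nat \<Rightarrow> 's) set"
  assumes "countable (UNIV :: 'g set)"
    and "locally compact (UNIV :: 'g set)"
    and "\<And>s. cyl A [s] \<noteq> {}"
    and "mixing A"
    and "add_subgroup F"
    and "partition_measurable A \<phi>"
    and "partition_measurable A g"
    and "partition_measurable A \<phi>'"
    and "\<And>x. x \<in> tms A \<Longrightarrow> \<phi>' x \<in> F"
    and "aperiodic_into A F \<phi>'"
    and "\<And>x. x \<in> tms A \<Longrightarrow> \<phi> x = a + g x - g (shift x) + \<phi>' x"
    and "sets \<nu> = sets (tms_borel A)"
    and "sigma_finite_measure \<nu>"
    and "emeasure \<nu> (tms A) \<noteq> 0"
    and "locally_finite_measure (tms_topology A) \<nu>"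
    and "U = topological_support (tms_topology A) \<nu>"
    and "openin (tms_topology A) U" and "closedin (tms_topology A) U"
    and "recurrent_measure A \<nu>"
    and "rel_invariant (tail_rel A \<phi>) \<nu>"
    and "rel_ergodic (tail_rel A \<phi>) \<nu>"
  shows "(\<exists>z0. U = {x \<in> tms A. g x \<in> (+) z0 ` F}) \<and>
         (\<exists>(h :: 'g \<Rightarrow> real) (c :: real) \<mu>.
           Modules.additive h \<and> c > 0 \<and>
           \<mu> \<in> partition_finite_measures A \<and> markov_measure A \<mu> \<and>
           is_shift_RN_deriv A \<mu> (\<lambda>x. ennreal (c * exp (h (\<phi> x)))) \<and>
           (\<forall>B \<in> sets \<nu>. emeasure \<nu> B = emeasure \<mu> (B \<inter> U)))"
proof -
  note nonempty = assms(3) and F = assms(5) and coboundary = assms(11)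
  obtain f where f: "\<And>x. x \<in> tms A \<Longrightarrow> \<phi> x = f (x 0)"
    using partition_measurable_state_function[OF assms(6)] by blast
  obtain \<gamma> where \<gamma>: "\<And>x. x \<in> tms A \<Longrightarrow> g x = \<gamma> (x 0)"
    using partition_measurable_state_function[OF assms(7)] by blast
  obtain b where b: "\<And>x. x \<in> tms A \<Longrightarrow> \<phi>' x = b (x 0)"
    using partition_measurable_state_function[OF assms(8)] by blast
  interpret sigma_finite_measure \<nu> by fact
  interpret invariant_measure_open_support A \<nu> \<phi> f
    by unfold_locales (use assms f in auto)
  have b_F: "b s \<in> F" for s
  proof -
    obtain x where "x \<in> cyl A [s]"
      using nonempty by blast
    then show ?thesis
      using b assms(9) by (metis cyl_single_iff)
  qed
  have f_eq: "f s = a + \<gamma> s - \<gamma> t + b s" if "A s t" for s t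
  proof -
    obtain y where "y \<in> cyl A [t]"
      using nonempty by blast
    then have y: "y \<in> tms A" "y 0 = t"
      by (auto simp: cyl_single_iff)
    then have x: "s ## y \<in> tms A"
      using that by (simp add: build_in_tms)
    moreover have "shift (s ## y) = y"
      by (simp add: shift_def)
    ultimately show ?thesis
      using coboundary[OF x] y by (simp add: f \<gamma> b)
  qed
  let ?P = "{birkhoff_sum \<phi>' n x - birkhoff_sum \<phi>' n y | n x y.
         n \<ge> 1 \<and> x \<in> tms A \<and> y \<in> tms A \<and> (shift ^^ n) x = x \<and> (shift ^^ n) y = y}"
  let ?L = "{word_sum b X - word_sum b Y | X Y x y.
      walk A x X x \<and> walk A y Y y \<and> length X = length Y}"
  have "F \<inter> group_closure ?P = F"
    using assms(10) unfolding aperiodic_into_def closure_of_countable_polish_group[OF assms(1)] .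
  then have "F \<subseteq> group_closure ?P"
    by blast
  moreover have "?P \<subseteq> ?L"
  proof
    fix z assume "z \<in> ?P"
    then obtain n x y where z: "z = birkhoff_sum \<phi>' n x - birkhoff_sum \<phi>' n y"
        and x: "x \<in> tms A" "suffix n x = x" and y: "y \<in> tms A" "suffix n y = y"
      unfolding shift_funpow by blast
    have "walk A (x 0) (prefix n x) (x 0)" if "x \<in> tms A" "suffix n x = x" for x
      using walk_prefix[OF that(1), of n] that(2) by (metis add_0_right suffix_nth)
    moreover have "birkhoff_sum \<phi>' n x = word_sum b (prefix n x)" if "x \<in> tms A" for x
      using b that by (rule birkhoff_sum_prefix)
    ultimately show "z \<in> ?L"
      using x y unfolding z
      by (intro CollectI exI[of _ "prefix n x"] exI[of _ "prefix n y"] exI[of _ "x 0"] exI[of _ "y 0"]) simp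
  qed
  then have "group_closure ?P \<subseteq> group_closure ?L"
    by (rule group_closure_mono)
  ultimately have gen: "F \<subseteq> group_closure ?L"
    by blast
  have link: "\<exists>v y. walk A t v u \<and> walk A u y u \<and> length v = length y \<and> word_sum f v = word_sum f y"
    if "\<gamma> t - \<gamma> u \<in> F" for t u
    using f_eq F b_F gen that by (rule linked_states)
  obtain u where u: "emeasure \<nu> (cyl A [u]) \<noteq> 0"
  proof -
    have "\<exists>u. emeasure \<nu> (cyl A [u]) \<noteq> 0"
    proof (rule ccontr)
      assume "\<not> ?thesis"
      moreover have "emeasure \<nu> (tms A \<inter> cyl A [t]) \<le> emeasure \<nu> (cyl A [t])" for t
        by (intro emeasure_mono) auto
      ultimately have "emeasure \<nu> (tms A \<inter> cyl A [t]) = 0" for t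
        by (metis le_zero_eq)
      then show False
        using assms(14) emeasure_partition[OF refl sets_M_tms] by simp
    qed
    then show ?thesis
      using that by blast
  qed
  have "emeasure \<nu> (cyl A [t]) \<noteq> 0 \<longleftrightarrow> \<gamma> t - \<gamma> u \<in> F" for t
  proof
    assume "\<gamma> t - \<gamma> u \<in> F"
    from link[OF this] obtain v y where vy: "walk A t v u" "walk A u y u" "length v = length y"
        "word_sum f v = word_sum f y"
      by blast
    have "emeasure \<nu> (cyl A (v @ [u])) = emeasure \<nu> (cyl A (y @ [u]))"
      using exchange[OF vy, of "cyl A [u]"] by (simp add: prepend_cyl)
    moreover have "emeasure \<nu> (cyl A (v @ [u])) \<le> emeasure \<nu> (cyl A [t])"
      using prepend_subset_cyl_walk[OF vy(1) order_refl] by (intro emeasure_mono) (simp_all add: prepend_cyl)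
    ultimately show "emeasure \<nu> (cyl A [t]) \<noteq> 0"
      using loop_positive[OF u vy(2)] by auto
  next
    \<comment> \<open>By ergodicity almost every point starting with \<open>t\<close> is related to a point starting with \<open>u\<close>.\<close>
    assume t: "emeasure \<nu> (cyl A [t]) \<noteq> 0"
    let ?S = "tail_rel A \<phi> `` cyl A [u]"
    have "emeasure \<nu> (cyl A [u]) \<le> emeasure \<nu> ?S"
      using subset_saturation[OF cyl_subset_tms] by (intro emeasure_mono sets_saturation) auto
    then have "emeasure \<nu> (tms A - ?S) = 0"
      using saturation_trivial[of "cyl A [u]"] u by auto
    moreover have "tms A - ?S \<in> sets \<nu>"
      by (intro sets.Diff sets_saturation) auto
    ultimately have "\<not> cyl A [t] \<subseteq> tms A - ?S"
      using t emeasure_mono[of "cyl A [t]" "tms A - ?S" \<nu>] by auto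
    then obtain y x where xy: "y \<in> cyl A [t]" "x \<in> cyl A [u]" "(x, y) \<in> tail_rel A \<phi>"
      using cyl_subset_tms by blast
    then obtain n where x: "x \<in> tms A" "x 0 = u" and y: "y \<in> tms A" "y 0 = t"
        and n: "suffix n x = suffix n y" "word_sum f (prefix n x) = word_sum f (prefix n y)"
      by (auto simp: tail_rel_iff cyl_single_iff)
    have "x n = y n"
      using fun_cong[OF n(1), of 0] by simp
    have sum: "word_sum f (prefix n x) = multiple n a + \<gamma> (x 0) - \<gamma> (x n) + word_sum b (prefix n x)"
      if "x \<in> tms A" for x
      using word_sum_coboundary[where f = f and a = a and \<gamma> = \<gamma> and b = b, OF f_eq walk_prefix[OF that, of n]]
      by simp
    have "\<gamma> t - \<gamma> u = word_sum b (prefix n x) - word_sum b (prefix n y)"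
      using n(2) unfolding sum[OF x(1)] sum[OF y(1)] x(2) y(2) \<open>x n = y n\<close>
      by (simp add: algebra_simps)
    moreover have "word_sum b w \<in> F" for w
      using F b_F by (induction w) (auto simp: add_subgroup_def)
    ultimately show "\<gamma> t - \<gamma> u \<in> F"
      using add_subgroup_diff[OF F] by simp
  qed
  note positive_iff = this
  have "g x \<in> (+) (\<gamma> u) ` F \<longleftrightarrow> emeasure \<nu> (cyl A [x 0]) \<noteq> 0" if "x \<in> tms A" for x
    unfolding positive_iff \<gamma>[OF that] by (force simp: image_iff algebra_simps)
  then have "U = {x \<in> tms A. g x \<in> (+) (\<gamma> u) ` F}"
    unfolding assms(16) support_eq by auto
  moreover have "\<exists>v y. walk A t v u \<and> walk A u y u \<and> length v = length y \<and> word_sum f v = word_sum f y"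
    if "emeasure \<nu> (cyl A [t]) \<noteq> 0" for t
    using link positive_iff that by blast
  ultimately show ?thesis
    using conformal_markov_extension[OF u] unfolding assms(16) by blast
qed

end
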